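(* Let $X$ and $Y$ be locally compact spaces, neither of which is pseudocompact. If $(\mathscr{U}(X),\leq)$ and $(\mathscr{U}(Y),\leq)$ are order-isomorphic, then $(\beta X\setminus X)\setminus\mathrm{cl}_{\beta X}(\beta X\setminus\upsilon X)$ and $(\beta Y\setminus Y)\setminus\mathrm{cl}_{\beta Y}(\beta Y\setminus\upsilon Y)$ are homeomorphic.
   Context: All spaces are completely regular Hausdorff. $\beta X$ is the Stone–Čech compactification and $\upsilon X\subseteq\beta X$ the Hewitt realcompactification of $X$. An extension of $X$ is a space containing $X$ as a dense subspace; its remainder is $Y\setminus X$. Extensions are identified up to homeomorphisms fixing $X$ pointwise, and $Y\leq Y'$ means there is a continuous map $Y'\to Y$ fixing $X$ pointwise. A space is pseudocompact if every continuous real-valued function on it is bounded. $\mathscr{U}(X)$ denotes the set of all pseudocompact extensions of $X$ with compact remainder, partially ordered by $\leq$. *)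

theory Defs
  imports "HOL-Analysis.Analysis"
begin

definition tychonoff_space :: "'a topology \<Rightarrow> bool" where
  "tychonoff_space X \<longleftrightarrow> completely_regular_space X \<and> Hausdorff_space X"

definition pseudocompact_space :: "'a topology \<Rightarrow> bool" where
  "pseudocompact_space X \<longleftrightarrow>
     (\<forall>f. continuous_map X euclideanreal f \<longrightarrow> bounded (f ` topspace X))"

definition is_extension :: "'a topology \<Rightarrow> 'b topology \<Rightarrow> ('a \<Rightarrow> 'b) \<Rightarrow> bool" where
  "is_extension X Y e \<longleftrightarrow> tychonoff_space Y \<and> embedding_map X Y e \<and>
     Y closure_of (e ` topspace X) = topspace Y"

definition remainder :: "'a topology \<Rightarrow> 'b topology \<Rightarrow> ('a \<Rightarrow> 'b) \<Rightarrow> 'b set" where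
  "remainder X Y e = topspace Y - e ` topspace X"

definition ext_le :: "'a topology \<Rightarrow> ('b topology \<times> ('a \<Rightarrow> 'b)) \<Rightarrow> ('c topology \<times> ('a \<Rightarrow> 'c)) \<Rightarrow> bool" where
  "ext_le X E E' \<longleftrightarrow>
     (\<exists>g. continuous_map (fst E') (fst E) g \<and> (\<forall>x\<in>topspace X. g (snd E' x) = snd E x))"

definition ext_equiv :: "'a topology \<Rightarrow> ('b topology \<times> ('a \<Rightarrow> 'b)) \<Rightarrow> ('c topology \<times> ('a \<Rightarrow> 'c)) \<Rightarrow> bool" where
  "ext_equiv X E E' \<longleftrightarrow>
     (\<exists>h. homeomorphic_map (fst E) (fst E') h \<and> (\<forall>x\<in>topspace X. h (snd E x) = snd E' x))"

text \<open>Representatives of extensions of X live on the type 'a set set: every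
  Hausdorff extension of X is equivalent to one on this type (send a point to the
  family of traces on X of its open neighbourhoods).\<close>
type_synonym 'a ext_rep = "'a set set topology \<times> ('a \<Rightarrow> 'a set set)"

definition ext_class :: "'a topology \<Rightarrow> 'a ext_rep \<Rightarrow> 'a ext_rep set" where
  "ext_class X E = {E'. is_extension X (fst E') (snd E') \<and> ext_equiv X E E'}"

definition U_ext :: "'a topology \<Rightarrow> 'a ext_rep set set" where
  "U_ext X = {ext_class X E | E. is_extension X (fst E) (snd E) \<and>
       pseudocompact_space (fst E) \<and> compactin (fst E) (remainder X (fst E) (snd E))}"

definition U_le :: "'a topology \<Rightarrow> 'a ext_rep set \<Rightarrow> 'a ext_rep set \<Rightarrow> bool" where
  "U_le X A B \<longleftrightarrow> (\<exists>E\<in>A. \<exists>E'\<in>B. ext_le X E E')"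

definition order_isomorphic_U :: "'a topology \<Rightarrow> 'b topology \<Rightarrow> bool" where
  "order_isomorphic_U X Y \<longleftrightarrow>
     (\<exists>\<phi>. bij_betw \<phi> (U_ext X) (U_ext Y) \<and>
        (\<forall>A\<in>U_ext X. \<forall>B\<in>U_ext X. U_le X A B \<longleftrightarrow> U_le Y (\<phi> A) (\<phi> B)))"

definition stone_cech :: "'a topology \<Rightarrow> 'b topology \<Rightarrow> ('a \<Rightarrow> 'b) \<Rightarrow> bool" where
  "stone_cech X K e \<longleftrightarrow> compact_space K \<and> Hausdorff_space K \<and> embedding_map X K e \<and>
     K closure_of (e ` topspace X) = topspace K \<and>
     (\<forall>f. continuous_map X (top_of_set {0..1}) f \<longrightarrow>
        (\<exists>g. continuous_map K euclideanreal g \<and> (\<forall>x\<in>topspace X. g (e x) = f x)))"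

text \<open>Hewitt realcompactification \<upsilon>X as a subset of \<beta>X = K: the points p such that
  every continuous real-valued function on X extends continuously to X \<union> {p}.\<close>
definition hewitt_in :: "'a topology \<Rightarrow> 'b topology \<Rightarrow> ('a \<Rightarrow> 'b) \<Rightarrow> 'b set" where
  "hewitt_in X K e = {p \<in> topspace K. \<forall>f. continuous_map X euclideanreal f \<longrightarrow>
     (\<exists>g. continuous_map (subtopology K (insert p (e ` topspace X))) euclideanreal g \<and>
          (\<forall>x\<in>topspace X. g (e x) = f x))}"

end

theory Submission
  imports Defs
begin

text \<open>Write \<open>R\<close> for the remainder of \<open>X\<close> in \<open>\<beta>X\<close> and \<open>A\<close> for the closure of \<open>\<beta>X - \<upsilon>X\<close>, which is
  nonempty because \<open>X\<close> is not pseudocompact. Every member of \<open>U(X)\<close> is a quotient of \<open>X \<union> C\<close> for a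
  closed \<open>C\<close> with \<open>A \<subseteq> C \<subseteq> R\<close>, by an equivalence relation that only identifies points of \<open>C\<close>; the order
  of \<open>U(X)\<close> is the reverse inclusion of these relations.
  The maximum is \<open>X \<union> A\<close>, and its lower covers either identify two points of \<open>A\<close> or are the spaces
  \<open>X \<union> A \<union> {r}\<close> with \<open>r \<in> R - A\<close>. The latter are recognised by the order: identifying \<open>r\<close> with a point
  of \<open>A\<close> gives an element above which there are only \<open>X \<union> A \<union> {r}\<close> and the maximum, while anything
  strictly below a lower cover of the first kind lies below a second lower cover.
  So the order determines the set \<open>R - A\<close>, and also its closed sets: they are the sets of those \<open>r\<close> for
  which \<open>X \<union> A \<union> {r}\<close> lies above a given member of \<open>U(X)\<close>.\<close>

section \<open>Pseudocompact extensions and their transport along homeomorphisms\<close>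

text \<open>The quotients are first built on the point type of \<open>K\<close> and only then moved
  to \<open>'a set set\<close>, so the condition defining \<open>U_ext\<close> is needed for
  extensions on any type.\<close>

definition U_member :: "'a topology \<Rightarrow> 'b topology \<Rightarrow> ('a \<Rightarrow> 'b) \<Rightarrow> bool" where
  "U_member X Z d \<longleftrightarrow> is_extension X Z d \<and> pseudocompact_space Z \<and> compactin Z (remainder X Z d)"

lemma pseudocompact_space_continuous_image:
  assumes "pseudocompact_space X" "continuous_map X Y f" "f ` topspace X = topspace Y"
  shows "pseudocompact_space Y"
  unfolding pseudocompact_space_def
proof (intro allI impI)
  fix g :: "'b \<Rightarrow> real" assume "continuous_map Y euclideanreal g"
  then have "continuous_map X euclideanreal (g \<circ> f)"
    using assms continuous_map_compose by blast
  then have "bounded ((g \<circ> f) ` topspace X)"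
    using assms unfolding pseudocompact_space_def by blast
  then show "bounded (g ` topspace Y)"
    by (simp add: assms(3) flip: image_image image_comp)
qed

lemma is_extension_homeomorphic_image:
  assumes d: "is_extension X Z d" and h: "homeomorphic_map Z Z' h"
  shows "is_extension X Z' (h \<circ> d)"
proof -
  have Z: "tychonoff_space Z" and emb: "embedding_map X Z d"
    and dense: "Z closure_of (d ` topspace X) = topspace Z"
    using d by (auto simp: is_extension_def)
  have hom: "Z homeomorphic_space Z'"
    using h homeomorphic_map_imp_homeomorphic_space by blast
  have "tychonoff_space Z'"
    using Z hom homeomorphic_completely_regular_space homeomorphic_Hausdorff_space
    by (metis tychonoff_space_def)
  moreover have "embedding_map X Z' (h \<circ> d)"
    by (metis emb embedding_map_compose h surjective_embedding_map)
  moreover have "d ` topspace X \<subseteq> topspace Z"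
    using emb by (metis continuous_map_image_subset_topspace continuous_map_into_fulltopology
        embedding_map_def homeomorphic_imp_continuous_map)
  then have "Z' closure_of ((h \<circ> d) ` topspace X) = topspace Z'"
    using homeomorphic_map_closure_of [OF h] dense homeomorphic_imp_surjective_map [OF h]
    by (metis image_comp)
  ultimately show ?thesis
    by (simp add: is_extension_def)
qed

lemma U_member_homeomorphic_image:
  assumes Z: "U_member X Z d" and h: "homeomorphic_map Z Z' h"
  shows "U_member X Z' (h \<circ> d)"
proof -
  have "pseudocompact_space Z'"
    using Z h pseudocompact_space_continuous_image
    by (metis U_member_def homeomorphic_imp_continuous_map homeomorphic_imp_surjective_map)
  moreover have "d ` topspace X \<subseteq> topspace Z"
    using Z unfolding U_member_def is_extension_def embedding_map_def
    by (metis continuous_map_image_subset_topspace continuous_map_into_fulltopology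
        homeomorphic_imp_continuous_map)
  then have "remainder X Z' (h \<circ> d) = h ` remainder X Z d"
    using homeomorphic_imp_surjective_map [OF h] homeomorphic_imp_injective_map [OF h]
    unfolding remainder_def image_comp [symmetric]
    by (metis inj_on_image_set_diff Diff_subset)
  then have "compactin Z' (remainder X Z' (h \<circ> d))"
    using Z h unfolding U_member_def
    by (metis homeomorphic_imp_continuous_map image_compactin)
  ultimately show ?thesis
    using Z h is_extension_homeomorphic_image unfolding U_member_def by blast
qed

text \<open>The copy carries the topology of \<open>Z\<close> pulled back along the inverse of
  \<open>j\<close>.\<close>

lemma homeomorphic_copy_exists:
  fixes Z :: "'b topology" and j :: "'b \<Rightarrow> 'c"
  assumes j: "inj_on j (topspace Z)"
  obtains Z' where "homeomorphic_map Z Z' j"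
proof
  let ?i = "inv_into (topspace Z) j"
  let ?Z' = "pullback_topology (j ` topspace Z) ?i Z"
  have ij: "?i (j z) = z" if "z \<in> topspace Z" for z
    using j that by simp
  have top: "topspace ?Z' = j ` topspace Z"
    using ij by (auto simp: topspace_pullback_topology)
  have "homeomorphic_maps Z ?Z' j ?i"
    unfolding homeomorphic_maps_def
  proof (intro conjI ballI)
    show "continuous_map Z ?Z' j"
    proof (rule continuous_map_pullback')
      show "continuous_map Z Z (?i \<circ> j)"
        using continuous_map_eq [OF continuous_map_id, of Z "?i \<circ> j"] ij by auto
    qed auto
    show "continuous_map ?Z' Z ?i"
      using continuous_map_pullback [OF continuous_map_id] by fastforce
  qed (use ij top in auto)
  then show "homeomorphic_map Z ?Z' j"
    by (rule homeomorphic_maps_imp_map)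
qed

text \<open>A point is sent to the traces on \<open>X\<close> of its open neighbourhoods. If
  distinct points with disjoint neighbourhoods \<open>U\<close> and \<open>U'\<close> had the same
  traces, then \<open>U\<close> would have the trace of some neighbourhood \<open>V\<close> of the
  second point; by density a point of \<open>X\<close> lands in \<open>V \<inter> U'\<close>, hence
  also in \<open>U\<close>.\<close>

lemma extension_representative:
  fixes X :: "'a topology" and Z :: "'b topology"
  assumes Z: "is_extension X Z d"
  obtains Z' :: "'a set set topology" and h where "homeomorphic_map Z Z' h"
proof -
  have haus: "Hausdorff_space Z" and dense: "Z closure_of (d ` topspace X) = topspace Z"
    using Z by (auto simp: is_extension_def tychonoff_space_def)
  define j where "j z = {{x \<in> topspace X. d x \<in> U} | U. openin Z U \<and> z \<in> U}" for z
  have "inj_on j (topspace Z)"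
  proof (rule inj_onI, rule ccontr)
    fix z z' assume z: "z \<in> topspace Z" "z' \<in> topspace Z" "j z = j z'" "z \<noteq> z'"
    then obtain U U' where U: "openin Z U" "openin Z U'" "z \<in> U" "z' \<in> U'" "disjnt U U'"
      using haus unfolding Hausdorff_space_def by meson
    have "{x \<in> topspace X. d x \<in> U} \<in> j z"
      unfolding j_def using U(1,3) by blast
    then have "{x \<in> topspace X. d x \<in> U} \<in> j z'"
      by (simp only: z(3))
    then obtain V where V: "openin Z V" "z' \<in> V"
        "{x \<in> topspace X. d x \<in> U} = {x \<in> topspace X. d x \<in> V}"
      unfolding j_def mem_Collect_eq by meson
    have "z' \<in> Z closure_of (d ` topspace X)"
      using z dense by simp
    moreover have "openin Z (V \<inter> U')" "z' \<in> V \<inter> U'"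
      using U V by auto
    ultimately obtain x where "x \<in> topspace X" "d x \<in> V \<inter> U'"
      unfolding in_closure_of by blast
    then show False
      using V U by (auto simp: disjnt_iff)
  qed
  then show thesis
    using homeomorphic_copy_exists that by metis
qed

text \<open>Choosing \<open>a\<close> as the common image keeps the quotient on the type of
  \<open>K\<close>; if \<open>a = b\<close>, nothing is identified. Saturating a closed set adds at
  most the points \<open>a\<close> and \<open>b\<close>, so the quotient map is closed, and closed
  continuous images of normal Hausdorff spaces are Hausdorff.\<close>

lemma pair_identification_exists:
  assumes K: "compact_space K" "Hausdorff_space K" and ab: "a \<in> topspace K" "b \<in> topspace K"
  defines "q \<equiv> \<lambda>x. if x = b then a else x"
  obtains Q where "Hausdorff_space Q" "compact_space Q" "continuous_map K Q q" "closed_map K Q q"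
    "q ` topspace K = topspace Q"
proof -
  define op where "op U \<longleftrightarrow> U \<subseteq> q ` topspace K \<and> openin K {x \<in> topspace K. q x \<in> U}" for U
  define Q where "Q = topology op"
  have "istopology op"
    unfolding istopology_def
  proof (intro conjI allI impI)
    fix U V assume "op U" "op V"
    then have "openin K ({x \<in> topspace K. q x \<in> U} \<inter> {x \<in> topspace K. q x \<in> V})"
      by (auto simp: op_def)
    moreover have "{x \<in> topspace K. q x \<in> U} \<inter> {x \<in> topspace K. q x \<in> V}
        = {x \<in> topspace K. q x \<in> U \<inter> V}"
      by auto
    ultimately show "op (U \<inter> V)"
      using \<open>op U\<close> by (auto simp: op_def)
  next
    fix \<U> assume "\<forall>U\<in>\<U>. op U"
    then have "openin K (\<Union>U\<in>\<U>. {x \<in> topspace K. q x \<in> U})" "\<Union>\<U> \<subseteq> q ` topspace K"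
      by (auto simp: op_def)
    moreover have "(\<Union>U\<in>\<U>. {x \<in> topspace K. q x \<in> U}) = {x \<in> topspace K. q x \<in> \<Union>\<U>}"
      by auto
    ultimately show "op (\<Union>\<U>)"
      by (auto simp: op_def)
  qed
  then have opQ: "openin Q U \<longleftrightarrow> op U" for U
    by (simp add: Q_def topology_inverse')
  have "op (q ` topspace K)"
  proof -
    have "{x \<in> topspace K. q x \<in> q ` topspace K} = topspace K"
      by auto
    then show ?thesis
      by (simp add: op_def)
  qed
  then have topQ: "q ` topspace K = topspace Q"
    by (metis opQ op_def openin_subset openin_topspace subset_antisym)
  have quo: "quotient_map K Q q"
    unfolding quotient_map_def using topQ opQ op_def by auto
  have closed: "closed_map K Q q"
    unfolding closed_map_def
  proof (intro allI impI)
    fix F assume F: "closedin K F"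
    have Fsub: "F \<subseteq> topspace K"
      using F closedin_subset by blast
    have "closedin K {x \<in> topspace K. q x \<in> q ` F}"
    proof (cases "a \<in> F \<or> b \<in> F")
      case True
      then have "{x \<in> topspace K. q x \<in> q ` F} = F \<union> {a, b}"
        using Fsub ab by (auto simp: q_def image_iff)
      moreover have "closedin K {a, b}"
        using K ab by (simp add: closedin_Hausdorff_finite)
      ultimately show ?thesis
        using F closedin_Un by metis
    next
      case False
      then have "{x \<in> topspace K. q x \<in> q ` F} = F"
        using Fsub ab by (auto simp: q_def image_iff split: if_splits)
      then show ?thesis
        using F by simp
    qed
    moreover have "q ` F \<subseteq> topspace Q"
      using Fsub topQ by blast
    ultimately show "closedin Q (q ` F)"
      using quo unfolding quotient_map_closedin by blast
  qed
  have cont: "continuous_map K Q q"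
    using quo quotient_imp_continuous_map by blast
  show thesis
  proof
    show "Hausdorff_space Q"
      using normal_Hausdorff_space_closed_continuous_map_image [OF _ _ closed cont topQ] K
        compact_Hausdorff_or_regular_imp_normal_space by blast
    show "compact_space Q"
      using cont K topQ by (metis compact_space_def image_compactin)
  qed (use cont closed topQ in auto)
qed

section \<open>Comparing extensions and their equivalence classes\<close>

lemma is_extension_in_topspace: "d x \<in> topspace Z" if "is_extension X Z d" "x \<in> topspace X"
proof -
  have "continuous_map X Z d"
    using that(1) unfolding is_extension_def embedding_map_def
    using homeomorphic_imp_continuous_map continuous_map_into_fulltopology by blast
  then show ?thesis
    using that(2) by (auto simp: continuous_map_def)
qed

lemma ext_equiv_imp_ext_le:
  assumes "ext_equiv X E E'" "is_extension X (fst E) (snd E)"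
  shows "ext_le X E E'" "ext_le X E' E"
proof -
  obtain h where h: "homeomorphic_map (fst E) (fst E') h" "\<forall>x\<in>topspace X. h (snd E x) = snd E' x"
    using assms(1) by (auto simp: ext_equiv_def)
  obtain k where k: "homeomorphic_maps (fst E) (fst E') h k"
    using h(1) homeomorphic_map_maps by blast
  show "ext_le X E' E"
    unfolding ext_le_def using h homeomorphic_imp_continuous_map by blast
  have "\<forall>x\<in>topspace X. k (snd E' x) = snd E x"
    using k h(2) is_extension_in_topspace [OF assms(2)]
    unfolding homeomorphic_maps_def by metis
  then show "ext_le X E E'"
    unfolding ext_le_def using k by (auto simp: homeomorphic_maps_def)
qed

lemma ext_le_trans:
  assumes "ext_le X E E'" "ext_le X E' E''"
  shows "ext_le X E E''"
proof -
  obtain g g' where g: "continuous_map (fst E') (fst E) g" "\<forall>x\<in>topspace X. g (snd E' x) = snd E x"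
    and g': "continuous_map (fst E'') (fst E') g'" "\<forall>x\<in>topspace X. g' (snd E'' x) = snd E' x"
    using assms by (auto simp: ext_le_def)
  have "continuous_map (fst E'') (fst E) (g \<circ> g')"
    using g' g continuous_map_compose by blast
  then show ?thesis
    unfolding ext_le_def using g(2) g'(2) by force
qed

lemma mem_ext_class_self: "E \<in> ext_class X E" if "is_extension X (fst E) (snd E)"
  using that unfolding ext_class_def ext_equiv_def by (auto intro!: exI [of _ id])

text \<open>\<open>U_le\<close> asks only for some pair of representatives. Equivalent extensions
  lie below each other, so transitivity makes the choice immaterial.\<close>

lemma U_le_ext_class:
  fixes E E' :: "'a ext_rep"
  assumes E: "is_extension X (fst E) (snd E)" and E': "is_extension X (fst E') (snd E')"
  shows "U_le X (ext_class X E) (ext_class X E') \<longleftrightarrow> ext_le X E E'"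
proof
  assume "U_le X (ext_class X E) (ext_class X E')"
  then obtain F F' :: "'a ext_rep" where F: "ext_equiv X E F" "ext_equiv X E' F'" "ext_le X F F'"
    unfolding U_le_def ext_class_def by blast
  then show "ext_le X E E'"
    using ext_equiv_imp_ext_le(1) [OF F(1) E] ext_equiv_imp_ext_le(2) [OF F(2) E'] ext_le_trans
    by blast
next
  assume "ext_le X E E'"
  then show "U_le X (ext_class X E) (ext_class X E')"
    unfolding U_le_def using mem_ext_class_self E E' by blast
qed

section \<open>Recovering a space from an order\<close>

text \<open>Up to equivalence, \<^term>\<open>t\<close> is a coatom, and some \<^term>\<open>x\<close> below it is such that the interval
  above \<^term>\<open>x\<close> is the three-element chain of \<^term>\<open>x\<close>, \<^term>\<open>t\<close> and the top.\<close>
definition isolated_coatom :: "'u set \<Rightarrow> ('u \<Rightarrow> 'u \<Rightarrow> bool) \<Rightarrow> 'u \<Rightarrow> bool" where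
  "isolated_coatom U le t \<longleftrightarrow> (\<exists>z\<in>U. \<not> le z t) \<and>
     (\<exists>x\<in>U. le x t \<and> \<not> le t x \<and>
        (\<forall>y\<in>U. le x y \<longrightarrow> le y x \<or> (le y t \<and> le t y) \<or> (\<forall>z\<in>U. le z y)))"

text \<open>\<open>le\<close> is treated as a preorder, so \<open>t\<close> lists the isolated
  coatoms only up to mutual \<open>le\<close>. The last two conjuncts express the points and the
  closed sets of \<open>P\<close> through the order, which is what an order isomorphism can carry
  over.\<close>

definition coded_by_coatoms :: "'p topology \<Rightarrow> 'u set \<Rightarrow> ('u \<Rightarrow> 'u \<Rightarrow> bool) \<Rightarrow> ('p \<Rightarrow> 'u) \<Rightarrow> bool" where
  "coded_by_coatoms P U le t \<longleftrightarrow>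
     (\<forall>u\<in>U. le u u) \<and>
     (\<forall>u\<in>U. \<forall>v\<in>U. \<forall>w\<in>U. le u v \<longrightarrow> le v w \<longrightarrow> le u w) \<and>
     t \<in> topspace P \<rightarrow> U \<and>
     (\<forall>r\<in>topspace P. \<forall>s\<in>topspace P. le (t r) (t s) \<longrightarrow> r = s) \<and>
     (\<forall>u\<in>U. isolated_coatom U le u \<longleftrightarrow> (\<exists>r\<in>topspace P. le u (t r) \<and> le (t r) u)) \<and>
     (\<forall>F. closedin P F \<longleftrightarrow> (\<exists>u\<in>U. F = {r \<in> topspace P. le u (t r)}))"

lemma coded_by_coatomsD:
  assumes "coded_by_coatoms P U le t"
  shows "u \<in> U \<Longrightarrow> le u u"
    and "\<lbrakk>le u v; le v w; u \<in> U; v \<in> U; w \<in> U\<rbrakk> \<Longrightarrow> le u w"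
    and "r \<in> topspace P \<Longrightarrow> t r \<in> U"
    and "\<lbrakk>le (t r) (t s); r \<in> topspace P; s \<in> topspace P\<rbrakk> \<Longrightarrow> r = s"
    and "u \<in> U \<Longrightarrow> isolated_coatom U le u \<longleftrightarrow> (\<exists>r\<in>topspace P. le u (t r) \<and> le (t r) u)"
    and "closedin P F \<longleftrightarrow> (\<exists>u\<in>U. F = {r \<in> topspace P. le u (t r)})"
proof -
  note * = assms [unfolded coded_by_coatoms_def]
  show "u \<in> U \<Longrightarrow> le u u" "r \<in> topspace P \<Longrightarrow> t r \<in> U"
    using * by auto
  show "\<lbrakk>le u v; le v w; u \<in> U; v \<in> U; w \<in> U\<rbrakk> \<Longrightarrow> le u w"
    using * [THEN conjunct2, THEN conjunct1] by blast
  show "\<lbrakk>le (t r) (t s); r \<in> topspace P; s \<in> topspace P\<rbrakk> \<Longrightarrow> r = s"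
    using * by simp
  show "u \<in> U \<Longrightarrow> isolated_coatom U le u \<longleftrightarrow> (\<exists>r\<in>topspace P. le u (t r) \<and> le (t r) u)"
    using * by simp
  show "closedin P F \<longleftrightarrow> (\<exists>u\<in>U. F = {r \<in> topspace P. le u (t r)})"
    using * by simp
qed

lemma isolated_coatom_order_iso:
  assumes bij: "bij_betw \<phi> U V" and ord: "\<And>u v. u \<in> U \<Longrightarrow> v \<in> U \<Longrightarrow> le u v \<longleftrightarrow> le' (\<phi> u) (\<phi> v)"
    and u: "u \<in> U"
  shows "isolated_coatom V le' (\<phi> u) \<longleftrightarrow> isolated_coatom U le u"
proof -
  have V: "V = \<phi> ` U"
    using bij by (simp add: bij_betw_def)
  show ?thesis
    unfolding isolated_coatom_def V by (simp add: ord u cong: bex_cong ball_cong)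
qed

text \<open>Being an isolated coatom is preserved by \<open>\<phi>\<close>, so
  \<open>\<phi> (t r)\<close> is equivalent to the code of some point, taken as \<open>h r\<close>.
  The preimage under \<open>h\<close> of the closed set coded by \<open>\<phi> u\<close> is the
  closed set coded by \<open>u\<close>.\<close>

lemma coded_by_coatoms_transfer:
  assumes P: "coded_by_coatoms P U le t" and Q: "coded_by_coatoms Q V le' s"
    and bij: "bij_betw \<phi> U V" and ord: "\<And>u v. u \<in> U \<Longrightarrow> v \<in> U \<Longrightarrow> le u v \<longleftrightarrow> le' (\<phi> u) (\<phi> v)"
  obtains h where "continuous_map P Q h"
    "\<And>r. r \<in> topspace P \<Longrightarrow> le' (\<phi> (t r)) (s (h r)) \<and> le' (s (h r)) (\<phi> (t r))"
proof -
  note tU = coded_by_coatomsD(3) [OF P] and sV = coded_by_coatomsD(3) [OF Q]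
  have \<phi>V: "\<And>u. u \<in> U \<Longrightarrow> \<phi> u \<in> V"
    using bij by (auto simp: bij_betw_def)
  note transQ = coded_by_coatomsD(2) [OF Q]
  have "\<exists>q\<in>topspace Q. le' (\<phi> (t r)) (s q) \<and> le' (s q) (\<phi> (t r))" if r: "r \<in> topspace P" for r
  proof -
    have "isolated_coatom U le (t r)"
      using coded_by_coatomsD(1,5) [OF P tU [OF r]] r by blast
    then have "isolated_coatom V le' (\<phi> (t r))"
      using isolated_coatom_order_iso [where u = "t r" and le = le and le' = le', OF bij] ord tU [OF r]
      by simp
    then show ?thesis
      using coded_by_coatomsD(5) [OF Q \<phi>V [OF tU [OF r]]] by simp
  qed
  then obtain h where h: "\<And>r. r \<in> topspace P \<Longrightarrow> h r \<in> topspace Q"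
    "\<And>r. r \<in> topspace P \<Longrightarrow> le' (\<phi> (t r)) (s (h r))"
    "\<And>r. r \<in> topspace P \<Longrightarrow> le' (s (h r)) (\<phi> (t r))"
    by metis
  have "continuous_map P Q h"
    unfolding continuous_map_closedin
  proof (intro conjI ballI allI impI)
    fix F assume "closedin Q F"
    then obtain v where v: "v \<in> V" "F = {q \<in> topspace Q. le' v (s q)}"
      unfolding coded_by_coatomsD(6) [OF Q] by blast
    then obtain u where u: "u \<in> U" "v = \<phi> u"
      using bij by (auto simp: bij_betw_def)
    have "h r \<in> F \<longleftrightarrow> le u (t r)" if r: "r \<in> topspace P" for r
    proof -
      have "le' v (s (h r)) \<longleftrightarrow> le' v (\<phi> (t r))"
        using transQ [OF _ h(2) [OF r] v(1)] transQ [OF _ h(3) [OF r] v(1)]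
          \<phi>V [OF tU [OF r]] sV [OF h(1) [OF r]] by blast
      then show ?thesis
        using v u h r ord tU by simp
    qed
    then have "{r \<in> topspace P. h r \<in> F} = {r \<in> topspace P. le u (t r)}"
      by blast
    then show "closedin P {r \<in> topspace P. h r \<in> F}"
      unfolding coded_by_coatomsD(6) [OF P] using u by blast
  qed (use h in auto)
  then show thesis
    using that h by blast
qed

text \<open>The maps obtained from \<open>\<phi>\<close> and from its inverse are mutually inverse:
  the code of a point lies below the code of its image under the composite, and comparable codes
  belong to equal points.\<close>

lemma coded_by_coatoms_homeomorphic:
  assumes P: "coded_by_coatoms P U le t" and Q: "coded_by_coatoms Q V le' s"
    and bij: "bij_betw \<phi> U V" and ord: "\<And>u v. u \<in> U \<Longrightarrow> v \<in> U \<Longrightarrow> le u v \<longleftrightarrow> le' (\<phi> u) (\<phi> v)"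
  shows "P homeomorphic_space Q"
proof -
  let ?\<psi> = "inv_into U \<phi>"
  have bij': "bij_betw ?\<psi> V U"
    by (rule bij_betw_inv_into [OF bij])
  have \<psi>: "?\<psi> v \<in> U" "\<phi> (?\<psi> v) = v" if "v \<in> V" for v
    using bij that bij_betw_inv_into_right bij_betwE [OF bij'] by fastforce+
  have \<phi>: "\<phi> u \<in> V" "?\<psi> (\<phi> u) = u" if "u \<in> U" for u
    using bij that bij_betw_inv_into_left bij_betwE [OF bij] by fastforce+
  have ord': "le' u v \<longleftrightarrow> le (?\<psi> u) (?\<psi> v)" if "u \<in> V" "v \<in> V" for u v
    using ord \<psi> that by simp
  obtain h where h: "continuous_map P Q h"
    "\<And>r. r \<in> topspace P \<Longrightarrow> le' (\<phi> (t r)) (s (h r)) \<and> le' (s (h r)) (\<phi> (t r))"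
    using coded_by_coatoms_transfer [OF P Q bij ord] by blast
  obtain k where k: "continuous_map Q P k"
    "\<And>q. q \<in> topspace Q \<Longrightarrow> le (?\<psi> (s q)) (t (k q)) \<and> le (t (k q)) (?\<psi> (s q))"
    using coded_by_coatoms_transfer [OF Q P bij' ord'] by blast
  have hQ: "h r \<in> topspace Q" if "r \<in> topspace P" for r
    using h(1) that by (auto simp: continuous_map_def)
  have kP: "k q \<in> topspace P" if "q \<in> topspace Q" for q
    using k(1) that by (auto simp: continuous_map_def)
  note tU = coded_by_coatomsD(3) [OF P] and sV = coded_by_coatomsD(3) [OF Q]
  note transP = coded_by_coatomsD(2) [OF P]
  note transQ = coded_by_coatomsD(2) [OF Q]
  have "k (h r) = r" if r: "r \<in> topspace P" for r
  proof -
    have "le (t r) (?\<psi> (s (h r)))"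
      using h(2)[OF r] ord' \<phi> tU [OF r] sV [OF hQ [OF r]] by metis
    moreover have "le (?\<psi> (s (h r))) (t (k (h r)))"
      using k(2) hQ r by blast
    ultimately have "le (t r) (t (k (h r)))"
      by (rule transP) (use tU kP hQ sV \<psi>(1) r in auto)
    then show ?thesis
      using coded_by_coatomsD(4) [OF P _ r kP [OF hQ [OF r]]] by simp
  qed
  moreover have "h (k q) = q" if q: "q \<in> topspace Q" for q
  proof -
    have "le' (s q) (\<phi> (t (k q)))"
      using k(2)[OF q] ord \<psi> sV [OF q] tU [OF kP [OF q]] by metis
    moreover have "le' (\<phi> (t (k q))) (s (h (k q)))"
      using h(2) kP q by blast
    ultimately have "le' (s q) (s (h (k q)))"
      by (rule transQ) (use tU kP hQ sV \<phi>(1) q in auto)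
    then show ?thesis
      using coded_by_coatomsD(4) [OF Q _ q hQ [OF kP [OF q]]] by simp
  qed
  ultimately have "homeomorphic_maps P Q h k"
    using h(1) k(1) by (auto simp: homeomorphic_maps_def)
  then show ?thesis
    using homeomorphic_space_def by blast
qed

section \<open>Extensions as quotients of subspaces of the Stone-Cech compactification\<close>

locale stone_cech_nonpseudocompact =
  fixes X :: "'a topology" and K :: "'k topology" and e :: "'a \<Rightarrow> 'k"
  assumes locally_compact: "locally_compact_space X"
    and not_pseudocompact: "\<not> pseudocompact_space X"
    and stone_cech: "stone_cech X K e"
begin

section \<open>The position of \<open>X\<close> inside its Stone-Cech compactification\<close>

definition S where "S = e ` topspace X"

definition A where "A = K closure_of (topspace K - hewitt_in X K e)"

lemma compact_K: "compact_space K" and Hausdorff_K: "Hausdorff_space K"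
  and embedding_e: "embedding_map X K e" and dense_S: "K closure_of S = topspace K"
  using stone_cech by (auto simp: stone_cech_def S_def)

lemma continuous_e: "continuous_map X K e"
  using embedding_e embedding_map_def homeomorphic_imp_continuous_map
    continuous_map_into_fulltopology by blast

lemma S_subset: "S \<subseteq> topspace K"
  unfolding S_def using continuous_e by (rule continuous_map_image_subset_topspace)

lemma normal_K: "normal_space K"
  using compact_K Hausdorff_K compact_Hausdorff_or_regular_imp_normal_space by blast

text \<open>Local compactness of \<open>X\<close> enters here. It makes the remainder closed in
  \<open>K\<close>, so closed subsets of the remainder are compact.\<close>

lemma openin_S: "openin K S"
proof (rule dense_locally_compact_openin_Hausdorff_space [OF Hausdorff_K S_subset dense_S])
  show "locally_compact_space (subtopology K S)"
    using embedding_map_imp_homeomorphic_space [OF embedding_e] locally_compact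
      homeomorphic_locally_compact_space by (auto simp: S_def)
qed

lemma dense_meets:
  assumes "openin K U" "p \<in> U"
  obtains x where "x \<in> topspace X" "e x \<in> U"
proof -
  have "U \<inter> S \<noteq> {}"
    using dense_intersects_open [of K S] dense_S assms by blast
  then show thesis
    using that by (auto simp: S_def)
qed

lemma eq_on_dense:
  assumes "S \<subseteq> T" "T \<subseteq> topspace K" "Hausdorff_space Q"
    and "continuous_map (subtopology K T) Q g" "continuous_map (subtopology K T) Q h"
    and "\<And>x. x \<in> topspace X \<Longrightarrow> g (e x) = h (e x)" "p \<in> T"
  shows "g p = h p"
proof (rule forall_in_closure_of_eq [of p "subtopology K T" S Q g h])
  show "p \<in> subtopology K T closure_of S"
    using assms dense_S by (auto simp: closure_of_subtopology Int_absorb1)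
  show "g y = h y" if "y \<in> S" for y
    using that assms(6) by (auto simp: S_def)
qed (use assms in auto)

text \<open>The definition of \<open>stone_cech\<close> extends functions into the unit interval; an
  affine rescaling passes to values in [-1, 1].\<close>

lemma extension_bounded:
  fixes f :: "'a \<Rightarrow> real"
  assumes f: "continuous_map X euclideanreal f" and b: "\<And>x. x \<in> topspace X \<Longrightarrow> \<bar>f x\<bar> \<le> 1"
  obtains F where "continuous_map K euclideanreal F" "\<And>x. x \<in> topspace X \<Longrightarrow> F (e x) = f x"
proof -
  have "continuous_map X euclideanreal (\<lambda>x. (f x + 1) / 2)"
    by (intro continuous_intros f) auto
  then have "continuous_map X (top_of_set {0..1}) (\<lambda>x. (f x + 1) / 2)"
    using b by (fastforce simp: continuous_map_in_subtopology abs_le_iff)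
  then obtain G where G: "continuous_map K euclideanreal G"
      "\<And>x. x \<in> topspace X \<Longrightarrow> G (e x) = (f x + 1) / 2"
    using stone_cech unfolding stone_cech_def by blast
  show thesis
  proof
    show "continuous_map K euclideanreal (\<lambda>p. 2 * G p - 1)"
      by (intro continuous_intros G) auto
  qed (simp add: G field_simps)
qed

lemma S_subset_hewitt: "S \<subseteq> hewitt_in X K e"
proof
  fix p assume p: "p \<in> S"
  have "\<exists>g. continuous_map (subtopology K (insert p S)) euclideanreal g \<and> (\<forall>x\<in>topspace X. g (e x) = f x)"
    if f: "continuous_map X euclideanreal f" for f
  proof -
    obtain i where i: "homeomorphic_maps X (subtopology K S) e i"
      using embedding_e unfolding embedding_map_def S_def homeomorphic_map_maps by blast
    then have "continuous_map (subtopology K S) euclideanreal (f \<circ> i)"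
      using f continuous_map_compose unfolding homeomorphic_maps_def by blast
    moreover have "\<forall>x\<in>topspace X. (f \<circ> i) (e x) = f x"
      using i unfolding homeomorphic_maps_def by auto
    ultimately show ?thesis
      using p by (metis insert_absorb)
  qed
  then show "p \<in> hewitt_in X K e"
    using p S_subset unfolding hewitt_in_def S_def by blast
qed

lemma closedin_A: "closedin K A"
  by (simp add: A_def)

lemma closedin_remainder: "closedin K (topspace K - S)"
  using openin_S by blast

lemma A_subset: "A \<subseteq> topspace K - S"
  unfolding A_def using S_subset_hewitt closedin_remainder by (intro closure_of_minimal) auto

section \<open>Pseudocompactness and the points outside the Hewitt realcompactification\<close>

text \<open>Take a function \<open>f\<close> on \<open>X\<close> without continuous extension to
  \<open>p\<close>, and let \<open>s\<close> extend the bounded function f / (1 + |f|) to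
  \<open>K\<close>. Then 1 - |s| equals 1 / (1 + |f|) on \<open>X\<close>, and it must vanish at
  \<open>p\<close>, since otherwise s / (1 - |s|) would extend \<open>f\<close> to
  \<open>p\<close>.\<close>

lemma not_in_hewitt_zero:
  assumes p: "p \<in> topspace K" "p \<notin> hewitt_in X K e"
  obtains \<phi> where "continuous_map K euclideanreal \<phi>" "\<phi> p = 0" "\<And>y. y \<in> S \<Longrightarrow> \<phi> y > 0"
proof -
  obtain f where f: "continuous_map X euclideanreal f"
    and nf: "\<And>g. continuous_map (subtopology K (insert p S)) euclideanreal g \<Longrightarrow>
                 \<exists>x\<in>topspace X. g (e x) \<noteq> f x"
    using p unfolding hewitt_in_def S_def by blast
  have ne: "1 + \<bar>f x\<bar> \<noteq> 0" for x
    by linarith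
  have "continuous_map X euclideanreal (\<lambda>x. f x / (1 + \<bar>f x\<bar>))"
    using ne by (intro continuous_intros f) auto
  moreover have "\<bar>f x / (1 + \<bar>f x\<bar>)\<bar> \<le> 1" for x
    by (simp add: field_simps)
  ultimately obtain s where s: "continuous_map K euclideanreal s"
      "\<And>x. x \<in> topspace X \<Longrightarrow> s (e x) = f x / (1 + \<bar>f x\<bar>)"
    using extension_bounded by blast
  define \<phi> where "\<phi> y = 1 - \<bar>s y\<bar>" for y
  have cont: "continuous_map K euclideanreal \<phi>"
    unfolding \<phi>_def by (intro continuous_intros s)
  have \<phi>e: "\<phi> (e x) = 1 / (1 + \<bar>f x\<bar>)" if "x \<in> topspace X" for x
    using that ne[of x] by (simp add: \<phi>_def s abs_divide field_simps)
  have pos: "\<phi> y > 0" if "y \<in> S" for y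
    using that \<phi>e by (auto simp: S_def)
  have "\<phi> p = 0"
  proof (rule ccontr)
    assume "\<phi> p \<noteq> 0"
    then have "continuous_map (subtopology K (insert p S)) euclideanreal (\<lambda>y. s y / \<phi> y)"
      using pos by (intro continuous_intros continuous_map_from_subtopology s cont) force+
    moreover have "s (e x) / \<phi> (e x) = f x" if "x \<in> topspace X" for x
      using that ne[of x] by (simp add: \<phi>e s)
    ultimately show False
      using nf by blast
  qed
  then show thesis
    using that cont pos by blast
qed

text \<open>Let \<open>H\<close> extend 1 / (1 + |g|) from \<open>X\<close> to \<open>K\<close>. It
  has no zero: on \<open>S \<union> C\<close> the formula persists, and any other point lies outside
  \<open>A\<close>, hence in the Hewitt realcompactification, where \<open>g\<close> extends to it
  with a finite value. By compactness \<open>H\<close> is bounded away from zero, which bounds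
  \<open>g\<close>.\<close>

lemma pseudocompact_subspace:
  assumes C: "A \<subseteq> C" "C \<subseteq> topspace K"
  shows "pseudocompact_space (subtopology K (S \<union> C))"
  unfolding pseudocompact_space_def
proof (intro allI impI)
  fix g assume g: "continuous_map (subtopology K (S \<union> C)) euclideanreal g"
  have T: "S \<subseteq> S \<union> C" "S \<union> C \<subseteq> topspace K"
    using C S_subset by auto
  have "continuous_map X (subtopology K (S \<union> C)) e"
    using continuous_e by (auto simp: continuous_map_in_subtopology S_def)
  then have ge: "continuous_map X euclideanreal (g \<circ> e)"
    using g continuous_map_compose by blast
  have ne: "1 + \<bar>r\<bar> \<noteq> 0" for r :: real
    by linarith
  have "continuous_map X euclideanreal (\<lambda>x. 1 / (1 + \<bar>(g \<circ> e) x\<bar>))"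
    using ne by (intro continuous_intros ge) auto
  then obtain H where H: "continuous_map K euclideanreal H"
      "\<And>x. x \<in> topspace X \<Longrightarrow> H (e x) = 1 / (1 + \<bar>g (e x)\<bar>)"
    using extension_bounded [of "\<lambda>x. 1 / (1 + \<bar>(g \<circ> e) x\<bar>)"] by auto
  have HT: "H y = 1 / (1 + \<bar>g y\<bar>)" if "y \<in> S \<union> C" for y
  proof (rule eq_on_dense [OF T Hausdorff_space_euclidean _ _ _ that])
    show "continuous_map (subtopology K (S \<union> C)) euclideanreal (\<lambda>y. 1 / (1 + \<bar>g y\<bar>))"
      using ne by (intro continuous_intros g) auto
  qed (use H continuous_map_from_subtopology in auto)
  have "H p \<noteq> 0" if p: "p \<in> topspace K" for p
  proof (cases "p \<in> S \<union> C")
    case True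
    then show ?thesis
      using HT ne by simp
  next
    case False
    then have "p \<in> hewitt_in X K e"
      using p C closure_of_subset [of "topspace K - hewitt_in X K e" K] by (auto simp: A_def)
    then obtain G where G: "continuous_map (subtopology K (insert p S)) euclideanreal G"
        "\<And>x. x \<in> topspace X \<Longrightarrow> G (e x) = g (e x)"
      using ge unfolding hewitt_in_def S_def by force
    have "(1 + \<bar>G p\<bar>) * H p = 1"
    proof (rule eq_on_dense [where T = "insert p S" and g = "\<lambda>y. (1 + \<bar>G y\<bar>) * H y" and h = "\<lambda>y. 1"
            and Q = euclideanreal])
      show "continuous_map (subtopology K (insert p S)) euclideanreal (\<lambda>y. (1 + \<bar>G y\<bar>) * H y)"
        by (intro continuous_intros G continuous_map_from_subtopology H)
    qed (use p S_subset H G ne in auto)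
    then show ?thesis
      by auto
  qed
  moreover have "compactin euclideanreal (H ` topspace K)"
    using H compact_K by (metis compact_space_def image_compactin)
  then have "compact (H ` topspace K)"
    by simp
  ultimately have "closed (H ` topspace K)" "0 \<notin> H ` topspace K"
    using compact_imp_closed by auto
  then obtain \<delta> where \<delta>: "\<delta> > 0" "\<forall>y\<in>H ` topspace K. \<delta> \<le> dist 0 y"
    using separate_point_closed by blast
  have "\<bar>g y\<bar> \<le> 1 / \<delta>" if y: "y \<in> S \<union> C" for y
  proof -
    have "\<delta> \<le> 1 / (1 + \<bar>g y\<bar>)"
      using \<delta>(2) HT[OF y] y T by fastforce
    then have "\<bar>g y\<bar> * \<delta> \<le> 1"
      using \<delta> by (simp add: field_simps)
    then show ?thesis
      using \<delta> by (simp add: field_simps)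
  qed
  then show "bounded (g ` topspace (subtopology K (S \<union> C)))"
    unfolding bounded_iff using T by auto
qed

text \<open>Were \<open>A\<close> empty, the preceding lemma with \<open>C\<close> empty would make
  the copy \<open>S\<close> of \<open>X\<close> pseudocompact.\<close>

lemma A_nonempty: "A \<noteq> {}"
proof
  assume "A = {}"
  then have "pseudocompact_space (subtopology K S)"
    using pseudocompact_subspace [of "{}"] by simp
  moreover obtain i where "homeomorphic_map (subtopology K S) X i"
    using embedding_e unfolding embedding_map_def S_def
    by (metis homeomorphic_map_maps homeomorphic_maps_sym)
  ultimately show False
    using not_pseudocompact pseudocompact_space_continuous_image
    by (metis homeomorphic_imp_continuous_map homeomorphic_imp_surjective_map)
qed

text \<open>The last conjunct makes \<^term>\<open>T\<close> the largest set to which \<^term>\<open>d\<close> extends continuously with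
  values in \<^term>\<open>Z\<close>, so \<^term>\<open>T\<close> and \<^term>\<open>f\<close> are determined by the extension.\<close>
definition resolves :: "'k set \<Rightarrow> ('k \<Rightarrow> 'z) \<Rightarrow> 'z topology \<Rightarrow> ('a \<Rightarrow> 'z) \<Rightarrow> bool" where
  "resolves T f Z d \<longleftrightarrow> S \<subseteq> T \<and> T \<subseteq> topspace K \<and> quotient_map (subtopology K T) Z f \<and>
     (\<forall>x\<in>topspace X. f (e x) = d x) \<and>
     (\<forall>p\<in>T. \<forall>x\<in>topspace X. f p = d x \<longrightarrow> p = e x) \<and>
     (\<forall>T' g. S \<subseteq> T' \<and> T' \<subseteq> topspace K \<and> continuous_map (subtopology K T') Z g \<and>
        (\<forall>x\<in>topspace X. g (e x) = d x) \<longrightarrow> T' \<subseteq> T \<and> (\<forall>p\<in>T'. g p = f p))"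

text \<open>A continuous map from compact \<open>K\<close> to Hausdorff \<open>Q\<close> is closed,
  and so is its restriction to the full preimage of \<open>M\<close>; hence that restriction is a
  quotient map.\<close>

lemma resolves_preimage:
  assumes Q: "Hausdorff_space Q" and F: "continuous_map K Q F"
    and d: "embedding_map X Q d" and Fe: "\<And>x. x \<in> topspace X \<Longrightarrow> F (e x) = d x"
    and M: "d ` topspace X \<subseteq> M" "M \<subseteq> F ` topspace K"
  shows "resolves {p \<in> topspace K. F p \<in> M} F (subtopology Q M) d"
proof -
  define T where "T = {p \<in> topspace K. F p \<in> M}"
  have T: "S \<subseteq> T" "T \<subseteq> topspace K"
    using S_subset M Fe by (auto simp: T_def S_def)
  have MQ: "M \<subseteq> topspace Q"
    using M F continuous_map_image_subset_topspace by fast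
  have "quotient_map (subtopology K T) (subtopology Q M) F"
  proof (rule continuous_closed_imp_quotient_map)
    show "continuous_map (subtopology K T) (subtopology Q M) F"
      using F by (auto simp: continuous_map_in_subtopology continuous_map_from_subtopology T_def)
    show "closed_map (subtopology K T) (subtopology Q M) F"
      using closed_map_restriction continuous_imp_closed_map [OF F compact_K Q] T_def by blast
    show "F ` topspace (subtopology K T) = topspace (subtopology Q M)"
      using M MQ by (auto simp: T_def)
  qed
  \<comment> \<open>No further point of \<open>T\<close> falls onto the copy of \<open>X\<close>.
    With disjoint neighbourhoods \<open>U\<close> of \<open>p\<close> and \<open>V\<close> of
    \<open>e x\<close>, the embedding \<open>d\<close> gives an open \<open>W\<close> that meets the
    copy of \<open>X\<close> exactly in the image of \<open>V\<close>. Near \<open>p\<close>,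
    density yields a point of \<open>S\<close> in \<open>U\<close> that is mapped into
    \<open>W\<close>, hence lies in \<open>V\<close>.\<close>
  moreover have "p = e x" if p: "p \<in> T" "x \<in> topspace X" "F p = d x" for p x
  proof (rule ccontr)
    assume "p \<noteq> e x"
    moreover have "p \<in> topspace K" "e x \<in> topspace K"
      using p T S_subset by (auto simp: S_def)
    ultimately obtain U V where U: "openin K U" "openin K V" "p \<in> U" "e x \<in> V" "disjnt U V"
      using Hausdorff_K unfolding Hausdorff_space_def by meson
    have "openin X {y \<in> topspace X. e y \<in> V}"
      using continuous_e U openin_continuous_map_preimage by blast
    then have "openin (subtopology Q (d ` topspace X)) (d ` {y \<in> topspace X. e y \<in> V})"
      using homeomorphic_imp_open_map [OF d [unfolded embedding_map_def]]
      unfolding open_map_def by blast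
    then obtain W where W: "openin Q W" "d ` {y \<in> topspace X. e y \<in> V} = W \<inter> d ` topspace X"
      by (auto simp: openin_subtopology)
    have inj: "inj_on d (topspace X)"
      using d embedding_map_def homeomorphic_imp_injective_map by blast
    have "openin K {y \<in> topspace K. F y \<in> W}"
      using F W openin_continuous_map_preimage by blast
    then have "openin K (U \<inter> {y \<in> topspace K. F y \<in> W})"
      using U by blast
    moreover have "d x \<in> W"
      using W U p by blast
    then have "p \<in> U \<inter> {y \<in> topspace K. F y \<in> W}"
      using p U \<open>p \<in> topspace K\<close> by auto
    ultimately obtain y where y: "y \<in> topspace X" "e y \<in> U" "F (e y) \<in> W"
      using dense_meets by blast
    then have "d y \<in> d ` {y \<in> topspace X. e y \<in> V}"
      using W Fe by auto
    then have "e y \<in> V"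
      using y inj by (auto dest: inj_onD)
    then show False
      using y U by (auto simp: disjnt_iff)
  qed
  \<comment> \<open>Maximality: \<open>g\<close> agrees with \<open>F\<close> on the dense set
    \<open>S\<close>, hence on \<open>T'\<close>, and its values lie in \<open>M\<close>.\<close>
  moreover have "T' \<subseteq> T \<and> (\<forall>p\<in>T'. g p = F p)"
    if g: "S \<subseteq> T'" "T' \<subseteq> topspace K" "continuous_map (subtopology K T') (subtopology Q M) g"
      "\<forall>x\<in>topspace X. g (e x) = d x" for T' g
  proof -
    have gQ: "continuous_map (subtopology K T') Q g" and gM: "g ` T' \<subseteq> M"
      using g by (auto simp: continuous_map_in_subtopology image_subset_iff Int_absorb1)
    have "g p = F p" if "p \<in> T'" for p
      using eq_on_dense [OF g(1,2) Q gQ continuous_map_from_subtopology [OF F] _ that] g Fe by auto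
    then show ?thesis
      using gM g(2) by (force simp: T_def)
  qed
  ultimately show ?thesis
    unfolding resolves_def T_def [symmetric] using T Fe by (intro conjI) (assumption | simp | blast)+
qed

lemma resolves_homeomorphic_image:
  assumes r: "resolves T f Z d" and h: "homeomorphic_map Z Z' h" and d: "d ` topspace X \<subseteq> topspace Z"
  shows "resolves T (h \<circ> f) Z' (h \<circ> d)"
proof -
  obtain k where k: "homeomorphic_maps Z Z' h k"
    using h homeomorphic_map_maps by blast
  have quo: "quotient_map (subtopology K T) Z f" and T: "T \<subseteq> topspace K"
    using r by (auto simp: resolves_def)
  then have fT: "f p \<in> topspace Z" if "p \<in> T" for p
    using that quotient_imp_surjective_map by fastforce
  have inj: "inj_on h (topspace Z)"
    using h homeomorphic_imp_injective_map by blast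
  have "quotient_map (subtopology K T) Z' (h \<circ> f)"
    using quo h quotient_map_compose homeomorphic_map_def by blast
  moreover have "p = e x" if "p \<in> T" "x \<in> topspace X" "h (f p) = h (d x)" for p x
  proof -
    have "f p = d x"
      using that fT d by (intro inj_onD [OF inj]) auto
    then show ?thesis
      using r that unfolding resolves_def by blast
  qed
  moreover have "T' \<subseteq> T \<and> (\<forall>p\<in>T'. g p = h (f p))"
    if g: "S \<subseteq> T'" "T' \<subseteq> topspace K" "continuous_map (subtopology K T') Z' g"
      "\<forall>x\<in>topspace X. g (e x) = h (d x)" for T' g
  proof -
    have "continuous_map (subtopology K T') Z (k \<circ> g)"
      using g(3) k continuous_map_compose unfolding homeomorphic_maps_def by blast
    moreover have "\<forall>x\<in>topspace X. (k \<circ> g) (e x) = d x"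
      using g(4) k d unfolding homeomorphic_maps_def by auto
    ultimately have "T' \<subseteq> T \<and> (\<forall>p\<in>T'. (k \<circ> g) p = f p)"
      using r g(1,2) unfolding resolves_def by blast
    moreover have "h (k (g p)) = g p" if "p \<in> T'" for p
    proof -
      have "g p \<in> topspace Z'"
        using g(2,3) that by (auto simp: continuous_map_def Pi_iff)
      then show ?thesis
        using k unfolding homeomorphic_maps_def by auto
    qed
    ultimately show ?thesis
      by (metis comp_apply)
  qed
  moreover have "S \<subseteq> T" "\<forall>x\<in>topspace X. f (e x) = d x"
    using r by (auto simp: resolves_def)
  ultimately show ?thesis
    unfolding resolves_def comp_apply using T by (intro conjI) (assumption | simp | blast)+
qed

text \<open>A map of extensions \<open>g\<close> makes \<open>g \<circ> f'\<close> an extension of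
  \<open>d\<close> to \<open>T'\<close>, so maximality of \<open>T\<close> forces it to equal
  \<open>f\<close> there. Conversely, the diagonal pairs of the inclusion give
  \<open>T' \<subseteq> T\<close>, and the remaining pairs let \<open>f\<close> factor through the
  quotient map \<open>f'\<close>.\<close>

lemma ext_le_iff_resolves:
  assumes r: "resolves T f Z d" and r': "resolves T' f' Z' d'"
  shows "ext_le X (Z, d) (Z', d') \<longleftrightarrow>
    {(p, q). p \<in> T' \<and> q \<in> T' \<and> f' p = f' q} \<subseteq> {(p, q). p \<in> T \<and> q \<in> T \<and> f p = f q}" (is "?L \<longleftrightarrow> ?R")
proof
  have quo: "quotient_map (subtopology K T) Z f" "quotient_map (subtopology K T') Z' f'"
    and T: "S \<subseteq> T" "T \<subseteq> topspace K" "S \<subseteq> T'" "T' \<subseteq> topspace K"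
    using r r' by (auto simp: resolves_def)
  {
    assume ?L
    then obtain g where g: "continuous_map Z' Z g" "\<And>x. x \<in> topspace X \<Longrightarrow> g (d' x) = d x"
      unfolding ext_le_def by auto
    then have "continuous_map (subtopology K T') Z (g \<circ> f')"
      using quo quotient_imp_continuous_map continuous_map_compose by blast
    moreover have "\<forall>x\<in>topspace X. (g \<circ> f') (e x) = d x"
      using g r' unfolding resolves_def by auto
    ultimately have "T' \<subseteq> T \<and> (\<forall>p\<in>T'. (g \<circ> f') p = f p)"
      using r T unfolding resolves_def by blast
    then show ?R
      by (auto simp: subset_iff) (metis comp_apply)
  next
    assume ?R
    then have "T' \<subseteq> T" and eq: "\<And>p q. p \<in> T' \<Longrightarrow> q \<in> T' \<Longrightarrow> f' p = f' q \<Longrightarrow> f p = f q"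
      by auto
    then have "continuous_map (subtopology K T') Z f"
      using quo quotient_imp_continuous_map
      by (metis continuous_map_from_subtopology_mono)
    then obtain g where g: "continuous_map Z' Z g" "\<And>p. p \<in> T' \<Longrightarrow> g (f' p) = f p"
      using quotient_map_lift_exists [OF quo(2)] eq T
      by (metis (no_types, lifting) Int_absorb1 topspace_subtopology)
    have "g (d' x) = d x" if "x \<in> topspace X" for x
    proof -
      have "e x \<in> T'" "f' (e x) = d' x" "f (e x) = d x"
        using that T r r' unfolding resolves_def S_def by auto
      then show ?thesis
        using g(2) by metis
    qed
    then show ?L
      unfolding ext_le_def using g(1) by auto
  }
qed

lemma resolves_e: "f (e x) = d x" if "resolves T f Z d" "x \<in> topspace X"
  using that by (simp add: resolves_def)

lemma resolves_fibre: "p = e x" if "resolves T f Z d" "p \<in> T" "x \<in> topspace X" "f p = d x"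
  using that by (simp add: resolves_def)

lemma resolves_cong:
  assumes "resolves T f Z d" "\<And>x. x \<in> topspace X \<Longrightarrow> d x = d' x"
  shows "resolves T f Z d'"
proof -
  have eq: "(\<forall>x\<in>topspace X. g (e x) = d x) \<longleftrightarrow> (\<forall>x\<in>topspace X. g (e x) = d' x)"
    "(\<forall>x\<in>topspace X. f p = d x \<longrightarrow> p = e x) \<longleftrightarrow> (\<forall>x\<in>topspace X. f p = d' x \<longrightarrow> p = e x)" for g p
    using assms(2) by auto
  show ?thesis
    using assms(1) unfolding resolves_def eq .
qed

text \<open>A point \<open>p\<close> outside both the Hewitt realcompactification and
  \<open>T - S\<close> would yield an unbounded function on \<open>Z\<close>: the reciprocal of a
  function that is positive on \<open>T\<close>, constant on \<open>T - S\<close> and zero at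
  \<open>p\<close>. So \<open>T - S\<close> contains all points outside the realcompactification
  and, being closed, their closure.\<close>

lemma A_subset_resolving_set:
  assumes r: "resolves T f Z d" and closed: "closedin K (T - S)" and Z: "pseudocompact_space Z"
  shows "A \<subseteq> T"
proof -
  have quo: "quotient_map (subtopology K T) Z f" and T: "S \<subseteq> T" "T \<subseteq> topspace K"
    using r by (auto simp: resolves_def)
  have "p \<in> T - S" if p: "p \<in> topspace K" "p \<notin> hewitt_in X K e" for p
  proof (rule ccontr)
    assume pT: "p \<notin> T - S"
    obtain \<phi> where \<phi>: "continuous_map K euclideanreal \<phi>" "\<phi> p = 0" "\<And>y. y \<in> S \<Longrightarrow> \<phi> y > 0"
      using not_in_hewitt_zero [OF p] by blast
    have "closedin K {p}"
      using Hausdorff_K p by (simp add: closedin_Hausdorff_sing_eq)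
    then obtain k where k: "continuous_map K euclideanreal k" "k ` {p} \<subseteq> {0}" "k ` (T - S) \<subseteq> {1}"
      using Urysohn_lemma_alt [OF normal_K _ closed, of "{p}"] pT by auto
    \<comment> \<open>The maximum gives each property in turn: \<open>\<phi>\<close> makes it
      positive on \<open>S\<close>, \<open>k\<close> makes it 1 on \<open>T - S\<close>, and both
      vanish at \<open>p\<close>. The caps at 1 make it exactly 1 on \<open>T - S\<close>.\<close>
    define F where "F y = max (min (\<phi> y) 1) (min (k y) 1)" for y
    have contF: "continuous_map K euclideanreal F"
      unfolding F_def by (intro continuous_intros \<phi> k)
    have F1: "F y = 1" if "y \<in> T - S" for y
      using that k by (auto simp: F_def)
    have Fpos: "F y > 0" if "y \<in> T" for y
      using that \<phi>(3)[of y] F1 by (cases "y \<in> S") (auto simp: F_def)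
    have Fp: "F p = 0"
      using k \<phi> by (simp add: F_def)
    have "continuous_map (subtopology K T) euclideanreal (\<lambda>y. 1 / F y)"
      using Fpos by (intro continuous_intros continuous_map_from_subtopology contF) force+
    \<comment> \<open>Points of \<open>S\<close> are alone in their fibres, so \<open>f\<close>
      identifies distinct points only within \<open>T - S\<close>, where \<open>F\<close> is
      constant.\<close>
    moreover have "1 / F y = 1 / F z" if yz: "y \<in> T" "z \<in> T" "f y = f z" for y z
    proof (cases "y \<in> S \<or> z \<in> S")
      case True
      then obtain x where x: "x \<in> topspace X" "y = e x \<or> z = e x"
        by (auto simp: S_def)
      then have "f y = d x" "f z = d x"
        using resolves_e [OF r x(1)] yz by auto
      then have "y = e x" "z = e x"
        using resolves_fibre [OF r _ x(1)] yz by auto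
      then show ?thesis
        by simp
    next
      case False
      then show ?thesis
        using F1 yz by simp
    qed
    ultimately obtain g where g: "continuous_map Z euclideanreal g"
        "\<And>y. y \<in> T \<Longrightarrow> g (f y) = 1 / F y"
      using quotient_map_lift_exists [OF quo, of euclideanreal "\<lambda>y. 1 / F y"] T
      by (metis (no_types, lifting) Int_absorb1 topspace_subtopology)
    then have "bounded (g ` topspace Z)"
      using Z by (simp add: pseudocompact_space_def)
    then obtain b where b: "b > 0" "\<And>z. z \<in> topspace Z \<Longrightarrow> \<bar>g z\<bar> \<le> b"
      by (auto simp: bounded_pos)
    have Fb: "F y \<ge> 1 / b" if "y \<in> T" for y
    proof -
      have "f y \<in> topspace Z"
        using that quo T quotient_imp_surjective_map by fastforce
      then have "1 / F y \<le> b"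
        using b(2)[of "f y"] g(2)[OF that] Fpos[OF that] by simp
      then show ?thesis
        using b Fpos[OF that] by (simp add: field_simps)
    qed
    have "openin K {y \<in> topspace K. F y \<in> {..<1 / b}}"
      using contF by (rule openin_continuous_map_preimage) simp
    then obtain x where "x \<in> topspace X" "F (e x) < 1 / b"
      using dense_meets [of "{y \<in> topspace K. F y \<in> {..<1 / b}}" p] p Fp b by auto
    then show False
      using Fb [of "e x"] T by (auto simp: S_def)
  qed
  then have "A \<subseteq> T - S"
    unfolding A_def by (intro closure_of_minimal closed) auto
  then show ?thesis
    by blast
qed

text \<open>Embed \<open>Z\<close> in a cube and extend the coordinates of \<open>X\<close> to
  \<open>K\<close>. The resulting map covers the image of \<open>Z\<close>, and \<open>T\<close> is
  the preimage of that image.\<close>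

lemma U_member_resolved:
  fixes Z :: "'z topology"
  assumes Z: "U_member X Z d"
  obtains T f where "resolves T f Z d" "closedin K (T - S)" "A \<subseteq> T"
proof -
  have Zcr: "completely_regular_space Z" "Hausdorff_space Z" and emb: "embedding_map X Z d"
    and dense: "Z closure_of (d ` topspace X) = topspace Z"
    and pc: "pseudocompact_space Z" and rem: "compactin Z (topspace Z - d ` topspace X)"
    using Z by (auto simp: U_member_def is_extension_def tychonoff_space_def remainder_def)
  have contd: "continuous_map X Z d"
    using emb embedding_map_def homeomorphic_imp_continuous_map
      continuous_map_into_fulltopology by blast
  then have dZ: "d ` topspace X \<subseteq> topspace Z"
    by (rule continuous_map_image_subset_topspace)
  obtain I :: "('z \<Rightarrow> real) set" and j
    where j: "embedding_map Z (product_topology (\<lambda>f. top_of_set {0..1::real}) I) j"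
    using completely_regular_space_cube_embedding [OF Zcr] by blast
  define Q where "Q = product_topology (\<lambda>f::'z \<Rightarrow> real. top_of_set {0..1::real}) I"
  have Q: "Hausdorff_space Q"
    unfolding Q_def by (simp add: Hausdorff_space_product_topology Hausdorff_space_subtopology)
  have embj: "embedding_map Z Q j"
    using j by (simp add: Q_def)
  have contj: "continuous_map Z Q j"
    using embj embedding_map_def homeomorphic_imp_continuous_map
      continuous_map_into_fulltopology by blast
  have contjd: "continuous_map X Q (j \<circ> d)"
    using contd contj continuous_map_compose by blast
  have "\<exists>G. continuous_map K euclideanreal G \<and> (\<forall>x\<in>topspace X. G (e x) = j (d x) i)"
    if i: "i \<in> I" for i
  proof -
    have "continuous_map X (top_of_set {0..1}) (\<lambda>x. (j \<circ> d) x i)"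
      using contjd i unfolding Q_def continuous_map_componentwise by blast
    then show ?thesis
      using stone_cech unfolding stone_cech_def by auto
  qed
  then obtain G where G: "\<And>i. i \<in> I \<Longrightarrow> continuous_map K euclideanreal (G i)"
    "\<And>i x. i \<in> I \<Longrightarrow> x \<in> topspace X \<Longrightarrow> G i (e x) = j (d x) i"
    by metis
  \<comment> \<open>The extensions \<open>G i\<close> are only known to be real-valued, so they are
    clamped to the unit interval; on \<open>X\<close> this changes nothing.\<close>
  define F where "F p = (\<lambda>i\<in>I. max 0 (min 1 (G i p)))" for p
  have jQ: "j z \<in> topspace Q" if "z \<in> topspace Z" for z
    using contj that by (auto simp: continuous_map_def Pi_iff)
  have contF: "continuous_map K Q F"
    unfolding Q_def continuous_map_componentwise
  proof (intro conjI ballI)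
    fix i assume i: "i \<in> I"
    have "continuous_map K euclideanreal (\<lambda>p. max 0 (min 1 (G i p)))"
      by (intro continuous_intros G i)
    then show "continuous_map K (top_of_set {0..1}) (\<lambda>p. F p i)"
      using i by (auto simp: continuous_map_in_subtopology F_def)
  qed (auto simp: F_def)
  have Fe: "F (e x) = (j \<circ> d) x" if x: "x \<in> topspace X" for x
  proof -
    have "j (d x) \<in> I \<rightarrow>\<^sub>E {0..1}"
      using jQ [of "d x"] x dZ by (auto simp: Q_def image_subset_iff)
    then show ?thesis
      using x G(2) by (intro ext) (auto simp: F_def PiE_iff extensional_def Pi_iff)
  qed
  define M where "M = j ` topspace Z"
  have M1: "(j \<circ> d) ` topspace X \<subseteq> M"
    using dZ by (auto simp: M_def)
  have "compactin Q (F ` topspace K)"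
    using contF compact_K by (metis compact_space_def image_compactin)
  then have "closedin Q (F ` topspace K)"
    using Q compactin_imp_closedin by blast
  moreover have "(j \<circ> d) ` topspace X \<subseteq> F ` topspace K"
    using Fe S_subset by (force simp: S_def image_iff)
  \<comment> \<open>The image of \<open>K\<close> is closed and contains the image of
    \<open>X\<close>, which is dense in \<open>M\<close>; so it contains \<open>M\<close>.\<close>
  moreover have "M \<subseteq> Q closure_of ((j \<circ> d) ` topspace X)"
    using continuous_map_image_closure_subset [OF contj, of "d ` topspace X"] dense
    by (simp add: M_def image_comp)
  ultimately have M2: "M \<subseteq> F ` topspace K"
    by (meson closure_of_minimal order_trans)
  define T where "T = {p \<in> topspace K. F p \<in> M}"
  have resQ: "resolves T F (subtopology Q M) (j \<circ> d)"
    unfolding T_def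
    using resolves_preimage [OF Q contF embedding_map_compose [OF emb embj] Fe M1 M2] by blast
  obtain k where k: "homeomorphic_maps Z (subtopology Q M) j k"
    using embj unfolding embedding_map_def M_def homeomorphic_map_maps by blast
  then have kj: "k (j z) = z" if "z \<in> topspace Z" for z
    using that by (auto simp: homeomorphic_maps_def)
  have homk: "homeomorphic_map (subtopology Q M) Z k"
    using k homeomorphic_maps_map by blast
  have "(j \<circ> d) ` topspace X \<subseteq> topspace (subtopology Q M)"
    using M1 dZ jQ by auto
  then have "resolves T (k \<circ> F) Z (k \<circ> (j \<circ> d))"
    by (rule resolves_homeomorphic_image [OF resQ homk])
  then have res: "resolves T (k \<circ> F) Z d"
    using dZ kj by (elim resolves_cong) auto
  \<comment> \<open>This set is the preimage of the compact remainder of \<open>Z\<close>, which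
    makes it closed.\<close>
  have "T - S = {p \<in> topspace K. F p \<in> j ` (topspace Z - d ` topspace X)}"
  proof (intro equalityI subsetI)
    fix p assume p: "p \<in> T - S"
    then obtain z where z: "z \<in> topspace Z" "F p = j z" "p \<in> topspace K"
      by (auto simp: T_def M_def)
    have "z \<notin> d ` topspace X"
    proof
      assume "z \<in> d ` topspace X"
      then obtain x where x: "x \<in> topspace X" "F p = (j \<circ> d) x"
        using z by auto
      then have "p = e x"
        using resolves_fibre [OF resQ _ x] p by blast
      then show False
        using x p by (auto simp: S_def)
    qed
    then show "p \<in> {p \<in> topspace K. F p \<in> j ` (topspace Z - d ` topspace X)}"
      using z by auto
  next
    fix p assume "p \<in> {p \<in> topspace K. F p \<in> j ` (topspace Z - d ` topspace X)}"
    then obtain z where z: "z \<in> topspace Z" "z \<notin> d ` topspace X" "F p = j z" "p \<in> topspace K"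
      by auto
    have "p \<notin> S"
    proof
      assume "p \<in> S"
      then obtain x where x: "x \<in> topspace X" "p = e x"
        by (auto simp: S_def)
      then have "j z = j (d x)"
        using Fe z by auto
      then have "z = d x"
        using kj z x dZ by (metis image_subset_iff)
      then show False
        using z x by blast
    qed
    then show "p \<in> T - S"
      using z by (auto simp: T_def M_def)
  qed
  moreover have "compactin Q (j ` (topspace Z - d ` topspace X))"
    using rem contj image_compactin by blast
  then have "closedin Q (j ` (topspace Z - d ` topspace X))"
    using Q compactin_imp_closedin by blast
  ultimately have closed: "closedin K (T - S)"
    using contF closedin_continuous_map_preimage by simp
  show thesis
    using that res closed A_subset_resolving_set [OF res closed pc] by blast
qed

text \<open>The order is decoded from these members alone: the subspaces
  \<open>S \<union> C\<close>, obtained for \<open>a = b\<close>, and their quotients by one pair of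
  remainder points. The gluing is done in all of \<open>K\<close> and then restricted, so that
  complete regularity is inherited from a compact Hausdorff space.\<close>

lemma collapse_exists:
  assumes C: "closedin K C" "A \<subseteq> C" "C \<subseteq> topspace K - S" and ab: "a \<in> C" "b \<in> C"
  obtains Z :: "'a set set topology" and d f where "U_member X Z d" "resolves (S \<union> C) f Z d"
    "{(p, q). p \<in> S \<union> C \<and> q \<in> S \<union> C \<and> f p = f q} = Id_on (S \<union> C) \<union> {(a, b), (b, a)}"
proof -
  define q where "q = (\<lambda>x. if x = b then a else x)"
  have abK: "a \<in> topspace K" "b \<in> topspace K"
    using ab C by auto
  obtain Q where Q: "Hausdorff_space Q" "compact_space Q" "continuous_map K Q q" "closed_map K Q q"
    "q ` topspace K = topspace Q"
    using pair_identification_exists [OF compact_K Hausdorff_K abK] unfolding q_def by blast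
  define T where "T = S \<union> C"
  define M where "M = q ` T"
  have TK: "T \<subseteq> topspace K"
    using C S_subset by (auto simp: T_def)
  have T: "{p \<in> topspace K. q p \<in> M} = T"
    using TK ab abK unfolding M_def T_def q_def by (auto split: if_splits)
  have qS: "q y = y" if "y \<in> S" for y
    using that ab C by (auto simp: q_def)
  have qSC: "q y \<in> q ` S \<longleftrightarrow> y \<in> S" for y
    using qS ab C by (force simp: q_def image_iff split: if_splits)
  have MQ: "M \<subseteq> topspace Q"
    using TK Q by (auto simp: M_def)
  \<comment> \<open>\<open>S\<close> is the full preimage of its image, so the restriction of the
    closed map \<open>q\<close> to it stays closed; it is injective because \<open>a\<close> and
    \<open>b\<close> lie outside \<open>S\<close>.\<close>
  have "embedding_map (subtopology K S) (subtopology Q (q ` S)) q"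
  proof (rule injective_closed_imp_embedding_map)
    show "continuous_map (subtopology K S) (subtopology Q (q ` S)) q"
      using Q by (auto simp: continuous_map_in_subtopology continuous_map_from_subtopology)
    show "closed_map (subtopology K S) (subtopology Q (q ` S)) q"
      using closed_map_restriction [OF Q(4), of "q ` S" S] qSC S_subset by auto
    show "inj_on q (topspace (subtopology K S))"
      using qS by (auto simp: inj_on_def)
  qed
  then have "embedding_map (subtopology K S) Q q"
    by (simp add: embedding_map_in_subtopology)
  moreover have "embedding_map X (subtopology K S) e"
    using embedding_e by (simp add: embedding_map_in_subtopology S_def)
  ultimately have emb: "embedding_map X Q (q \<circ> e)"
    using embedding_map_compose by blast
  have M1: "(q \<circ> e) ` topspace X \<subseteq> M"
    by (auto simp: M_def T_def S_def)
  have res: "resolves T q (subtopology Q M) (q \<circ> e)"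
    using resolves_preimage [OF Q(1,3) emb _ M1] TK unfolding T by (simp add: M_def image_mono)
  have ext: "is_extension X (subtopology Q M) (q \<circ> e)"
    unfolding is_extension_def
  proof (intro conjI)
    have "completely_regular_space Q"
      using Q compact_Hausdorff_or_regular_imp_normal_space
        normal_imp_completely_regular_space_gen Hausdorff_imp_t1_space by blast
    then show "tychonoff_space (subtopology Q M)"
      using Q by (simp add: tychonoff_space_def completely_regular_space_subtopology
          Hausdorff_space_subtopology)
    show "embedding_map X (subtopology Q M) (q \<circ> e)"
      using emb M1 by (simp add: embedding_map_in_subtopology)
    have "topspace Q \<subseteq> Q closure_of (q ` S)"
      using continuous_map_image_closure_subset [OF Q(3), of S] dense_S Q(5) by simp
    moreover have "(q \<circ> e) ` topspace X = q ` S" "M \<inter> q ` S = q ` S"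
      by (auto simp: S_def M_def T_def)
    ultimately show "subtopology Q M closure_of (q \<circ> e) ` topspace X = topspace (subtopology Q M)"
      using MQ by (auto simp: closure_of_subtopology)
  qed
  have "pseudocompact_space (subtopology Q M)"
  proof (rule pseudocompact_space_continuous_image)
    show "pseudocompact_space (subtopology K T)"
      unfolding T_def using C by (intro pseudocompact_subspace) auto
    show "continuous_map (subtopology K T) (subtopology Q M) q"
      using Q by (auto simp: continuous_map_in_subtopology continuous_map_from_subtopology M_def)
    show "q ` topspace (subtopology K T) = topspace (subtopology Q M)"
      using TK MQ by (auto simp: M_def)
  qed
  moreover have "remainder X (subtopology Q M) (q \<circ> e) = q ` C"
  proof -
    have "remainder X (subtopology Q M) (q \<circ> e) = M - q ` S"
      using MQ by (auto simp: remainder_def S_def)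
    also have "\<dots> = q ` C"
      using qSC C by (auto simp: M_def T_def)
    finally show ?thesis .
  qed
  moreover have "compactin Q (q ` C)"
    using C compact_K Q(3) closedin_compact_space image_compactin by blast
  ultimately have mem: "U_member X (subtopology Q M) (q \<circ> e)"
    unfolding U_member_def using ext by (auto simp: compactin_subtopology M_def T_def)
  obtain Z :: "'a set set topology" and h where h: "homeomorphic_map (subtopology Q M) Z h"
    using extension_representative [OF ext] .
  show thesis
  proof
    show "U_member X Z (h \<circ> (q \<circ> e))"
      using mem h U_member_homeomorphic_image by blast
    show "resolves (S \<union> C) (h \<circ> q) Z (h \<circ> (q \<circ> e))"
      using resolves_homeomorphic_image [OF res h] M1 MQ by (auto simp: T_def)
    have inj: "inj_on h M"
      using h MQ homeomorphic_imp_injective_map by (metis Int_absorb1 topspace_subtopology)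
    have "h (q y) = h (q z) \<longleftrightarrow> q y = q z" if "y \<in> T" "z \<in> T" for y z
      using that inj by (auto simp: inj_on_def M_def)
    then have "{(p, r). p \<in> S \<union> C \<and> r \<in> S \<union> C \<and> (h \<circ> q) p = (h \<circ> q) r}
        = {(p, r). p \<in> T \<and> r \<in> T \<and> q p = q r}"
      by (auto simp: T_def)
    also have "\<dots> = Id_on T \<union> {(a, b), (b, a)}"
      using ab by (auto simp: q_def T_def Id_on_iff split: if_splits)
    finally show "{(p, r). p \<in> S \<union> C \<and> r \<in> S \<union> C \<and> (h \<circ> q) p = (h \<circ> q) r}
        = Id_on (S \<union> C) \<union> {(a, b), (b, a)}"
      by (simp add: T_def)
  qed
qed

section \<open>The order on the pseudocompact extensions with compact remainder\<close>

text \<open>Conditions met by the identification relation of every member: its diagonal records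
  \<open>S \<union> C\<close>, and off-diagonal pairs lie in \<open>C\<close>. No claim is made that
  each such relation comes from a member.\<close>

definition kernels :: "('k \<times> 'k) set set" where
  "kernels = {E. \<exists>C. closedin K C \<and> A \<subseteq> C \<and> C \<subseteq> topspace K - S \<and>
     Id_on (S \<union> C) \<subseteq> E \<and> E \<subseteq> Id_on S \<union> C \<times> C \<and> sym E}"

text \<open>From here on the argument concerns relations ordered by reverse inclusion. The code of
  \<open>r\<close> is the diagonal of \<open>S \<union> insert r A\<close>.\<close>

lemma kernels_coded:
  fixes U :: "'u set" and c :: "'u \<Rightarrow> ('k \<times> 'k) set"
  assumes c: "\<And>u. u \<in> U \<Longrightarrow> c u \<in> kernels"
    and le: "\<And>u v. u \<in> U \<Longrightarrow> v \<in> U \<Longrightarrow> le u v \<longleftrightarrow> c v \<subseteq> c u"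
    and collapse: "\<And>C a b. closedin K C \<Longrightarrow> A \<subseteq> C \<Longrightarrow> C \<subseteq> topspace K - S \<Longrightarrow> a \<in> C \<Longrightarrow> b \<in> C \<Longrightarrow>
      \<exists>u\<in>U. c u = Id_on (S \<union> C) \<union> {(a, b), (b, a)}"
  obtains t where "coded_by_coatoms (subtopology K ((topspace K - S) - A)) U le t"
proof -
  define R where "R = (topspace K - S) - A"
  \<comment> \<open>The point \<open>a0\<close> serves twice: the degenerate pair
    \<open>(a0, a0)\<close> yields the unglued subspaces, and gluing \<open>r\<close> to
    \<open>a0\<close> gives the witness below the code of \<open>r\<close>.\<close>
  obtain a0 where a0: "a0 \<in> A"
    using A_nonempty by blast
  have subspace: "\<exists>u\<in>U. c u = Id_on (S \<union> C)" if C: "closedin K C" "A \<subseteq> C" "C \<subseteq> topspace K - S" for C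
  proof -
    have "a0 \<in> C"
      using C a0 by blast
    then obtain u where "u \<in> U" "c u = Id_on (S \<union> C) \<union> {(a0, a0), (a0, a0)}"
      using collapse [OF C, of a0 a0] by blast
    moreover have "Id_on (S \<union> C) \<union> {(a0, a0), (a0, a0)} = Id_on (S \<union> C)"
      using \<open>a0 \<in> C\<close> by auto
    ultimately show ?thesis
      by auto
  qed
  have closed_insert: "closedin K (insert r A)" if "r \<in> R" for r
  proof -
    have "closedin K {r}"
      using that Hausdorff_K by (simp add: R_def closedin_Hausdorff_sing_eq)
    then show ?thesis
      using closedin_A closedin_Un by (metis insert_is_Un)
  qed
  have insert_sub: "insert r A \<subseteq> topspace K - S" if "r \<in> R" for r
    using that A_subset by (auto simp: R_def)
  have "\<exists>u\<in>U. c u = Id_on (S \<union> insert r A)" if "r \<in> R" for r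
    using subspace [OF closed_insert [OF that] _ insert_sub [OF that]] by blast
  then obtain t where t: "\<And>r. r \<in> R \<Longrightarrow> t r \<in> U" "\<And>r. r \<in> R \<Longrightarrow> c (t r) = Id_on (S \<union> insert r A)"
    by metis
  have kernelE: "\<exists>C. closedin K C \<and> A \<subseteq> C \<and> C \<subseteq> topspace K - S \<and>
      Id_on (S \<union> C) \<subseteq> c u \<and> c u \<subseteq> Id_on S \<union> C \<times> C \<and> sym (c u)" if "u \<in> U" for u
    using c [OF that] by (simp add: kernels_def)
  obtain top where top: "top \<in> U" "c top = Id_on (S \<union> A)"
    using subspace [OF closedin_A _ A_subset] by blast
  have le_top: "le z top" if "z \<in> U" for z
  proof -
    have "Id_on (S \<union> A) \<subseteq> c z"
      using kernelE [OF that] by (fastforce simp: Id_on_iff)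
    then show ?thesis
      using le [OF that top(1)] top(2) by blast
  qed
  have top_iff: "(\<forall>z\<in>U. le z y) \<longleftrightarrow> c y \<subseteq> Id_on (S \<union> A)" if y: "y \<in> U" for y
  proof
    assume "\<forall>z\<in>U. le z y"
    then show "c y \<subseteq> Id_on (S \<union> A)"
      using le [OF top(1) y] top by auto
  next
    assume "c y \<subseteq> Id_on (S \<union> A)"
    then show "\<forall>z\<in>U. le z y"
      using le_top le top y by (metis order_trans)
  qed
  \<comment> \<open>Every relation contains the diagonal of \<open>S \<union> A\<close>, so only the
    pair \<open>(r, r)\<close> is at stake: the condition says that \<open>r\<close> belongs to the
    closed set of \<open>u\<close>.\<close>
  have le_t: "le u (t r) \<longleftrightarrow> (r, r) \<in> c u" if u: "u \<in> U" and r: "r \<in> R" for u r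
  proof -
    have "Id_on (S \<union> A) \<subseteq> c u"
      using kernelE [OF u] by (fastforce simp: Id_on_iff)
    then show ?thesis
      unfolding le [OF u t(1) [OF r]] t(2) [OF r] by (auto simp: Id_on_iff)
  qed
  have t_not_top: "\<not> c (t r) \<subseteq> Id_on (S \<union> A)" if "r \<in> R" for r
    using that t by (auto simp: R_def)
  have coatom: "isolated_coatom U le u" if u: "u \<in> U" and r: "r \<in> R" "le u (t r)" "le (t r) u" for u r
  proof -
    have cu: "c u = Id_on (S \<union> insert r A)"
      using r u t le by (metis subset_antisym)
    obtain x where x: "x \<in> U" "c x = Id_on (S \<union> insert r A) \<union> {(r, a0), (a0, r)}"
      using collapse [OF closed_insert [OF r(1)] _ insert_sub [OF r(1)], of r a0] a0 by auto
    have ra0: "r \<noteq> a0"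
      using r a0 by (auto simp: R_def)
    have "c y = c x \<or> c y = c u \<or> c y \<subseteq> Id_on (S \<union> A)" if y: "y \<in> U" and xy: "c y \<subseteq> c x" for y
    proof -
      obtain C where C: "A \<subseteq> C" "C \<subseteq> topspace K - S" "Id_on (S \<union> C) \<subseteq> c y"
          "c y \<subseteq> Id_on S \<union> C \<times> C" "sym (c y)"
        using kernelE [OF y] by blast
      have "C \<subseteq> insert r A"
      proof
        fix z assume z: "z \<in> C"
        then have "(z, z) \<in> c x"
          using C(3) xy by auto
        then show "z \<in> insert r A"
          using x(2) z C(2) a0 by auto
      qed
      \<comment> \<open>If \<open>C = A\<close>, the pair of \<open>r\<close> and \<open>a0\<close>
        is excluded and only the top remains. Otherwise, by symmetry, the presence of
        \<open>(r, a0)\<close> decides between \<open>x\<close> and \<open>u\<close>.\<close>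
      then consider "C = A" | "C = insert r A"
        using C(1) by blast
      then show ?thesis
      proof cases
        case 1
        have "c y \<subseteq> Id_on (S \<union> A)"
        proof (rule subrelI)
          fix p q assume pq: "(p, q) \<in> c y"
          then have "(p, q) \<in> c x" "(p, q) \<in> Id_on S \<union> A \<times> A"
            using xy C(4) 1 by auto
          then show "(p, q) \<in> Id_on (S \<union> A)"
            using x(2) r by (auto simp: R_def)
        qed
        then show ?thesis
          by blast
      next
        case 2
        then have sub: "Id_on (S \<union> insert r A) \<subseteq> c y"
          using C(3) by simp
        show ?thesis
        proof (cases "(r, a0) \<in> c y")
          case True
          then have "(a0, r) \<in> c y"
            using C(5) by (auto dest: symD)
          then have "c x \<subseteq> c y"
            using True sub x(2) by auto
          then show ?thesis
            using xy by blast
        next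
          case False
          then have "(a0, r) \<notin> c y"
            using C(5) by (auto dest: symD)
          then have "c y \<subseteq> c u"
            using False xy x(2) cu by blast
          then show ?thesis
            using sub cu by blast
        qed
      qed
    qed
    then have "\<forall>y\<in>U. le x y \<longrightarrow> le y x \<or> (le y u \<and> le u y) \<or> (\<forall>z\<in>U. le z y)"
      using le top_iff x(1) u by (metis order_refl)
    moreover have "le x u" "\<not> le u x"
      using le x u cu ra0 by auto
    moreover have "\<exists>z\<in>U. \<not> le z u"
      using top_iff [OF u] cu t_not_top [OF r(1)] t(2) [OF r(1)] by auto
    ultimately show ?thesis
      unfolding isolated_coatom_def using x(1) by blast
  qed
  have coatomD: "\<exists>r\<in>R. le u (t r) \<and> le (t r) u" if u: "u \<in> U" and iso: "isolated_coatom U le u" for u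
  proof -
    obtain x where x: "x \<in> U" "le x u" "\<not> le u x"
      and between: "\<And>y. y \<in> U \<Longrightarrow> le x y \<Longrightarrow> le y x \<or> (le y u \<and> le u y) \<or> (\<forall>z\<in>U. le z y)"
      using iso unfolding isolated_coatom_def by blast
    have u_not_top: "\<not> c u \<subseteq> Id_on (S \<union> A)"
      using iso top_iff [OF u] unfolding isolated_coatom_def by blast
    have cux: "c u \<subseteq> c x" "\<not> c x \<subseteq> c u"
      using le x u by auto
    obtain C where C: "A \<subseteq> C" "C \<subseteq> topspace K - S" "Id_on (S \<union> C) \<subseteq> c u"
        "c u \<subseteq> Id_on S \<union> C \<times> C" "sym (c u)"
      using kernelE [OF u] by blast
    obtain D where D: "A \<subseteq> D" "D \<subseteq> topspace K - S" "Id_on (S \<union> D) \<subseteq> c x"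
        "c x \<subseteq> Id_on S \<union> D \<times> D" "sym (c x)"
      using kernelE [OF x(1)] by blast
    \<comment> \<open>If the closed set of \<open>x\<close> were just \<open>A\<close>, some pair
      identified by \<open>x\<close> but not by \<open>u\<close> would lie in
      \<open>A \<times> A\<close>. Gluing that pair alone gives a \<open>y\<close> above
      \<open>x\<close> that is equivalent neither to \<open>x\<close> nor to \<open>u\<close> and is
      not a top.\<close>
    have "\<exists>r. r \<in> D - A"
    proof (rule ccontr)
      assume "\<not> (\<exists>r. r \<in> D - A)"
      then have DA: "D = A"
        using D(1) by blast
      obtain a b where ab: "(a, b) \<in> c x" "(a, b) \<notin> c u"
        using cux by auto
      have abA: "a \<in> A" "b \<in> A"
        using ab D(4) C(3) DA by auto
      obtain y where y: "y \<in> U" "c y = Id_on (S \<union> A) \<union> {(a, b), (b, a)}"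
        using collapse [OF closedin_A _ A_subset abA] by blast
      have "(b, a) \<in> c x"
        using ab D(5) by (auto dest: symD)
      then have "c y \<subseteq> c x"
        using y(2) ab D(3) DA by auto
      then have "le x y"
        using le x y by blast
      \<comment> \<open>Otherwise the relation of \<open>u\<close> would lie in that of
        \<open>y\<close> while missing both \<open>(a, b)\<close> and \<open>(b, a)\<close>, making
        \<open>u\<close> a top.\<close>
      moreover have "\<not> le y x"
      proof
        assume "le y x"
        then have "c x \<subseteq> c y"
          using le x y by blast
        moreover have "(b, a) \<notin> c u"
          using ab C(5) by (auto dest: symD)
        ultimately show False
          using cux(1) ab y(2) u_not_top by blast
      qed
      moreover have "\<not> le u y"
        using le [OF u y(1)] y(2) ab by auto
      moreover have "a \<noteq> b"
        using ab C(1,3) abA by auto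
      then have "\<not> (\<forall>z\<in>U. le z y)"
        using top_iff [OF y(1)] y(2) by auto
      ultimately show False
        using between y(1) by blast
    qed
    then obtain r where "r \<in> D - A"
      by blast
    then have r: "r \<in> R" "(r, r) \<in> c x"
      using D(2,3) by (auto simp: R_def)
    have tr: "t r \<in> U" "le x (t r)"
      using r le_t x t by auto
    have "\<not> (\<forall>z\<in>U. le z (t r))"
      using top_iff [OF tr(1)] t_not_top [OF r(1)] by simp
    \<comment> \<open>Otherwise the relations of \<open>u\<close> and \<open>x\<close> both lie in
      the diagonal of \<open>S \<union> insert r A\<close>. If \<open>u\<close> contains
      \<open>(r, r)\<close>, it contains all of \<open>x\<close>; if not, \<open>u\<close> is a top.
      Once this is excluded, the code of \<open>r\<close> must be equivalent to
      \<open>u\<close>.\<close>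
    moreover have "\<not> le (t r) x"
    proof
      assume "le (t r) x"
      then have sub: "c u \<subseteq> Id_on (S \<union> insert r A)" "c x \<subseteq> Id_on (S \<union> insert r A)"
        using le [OF tr(1) x(1)] t(2) [OF r(1)] cux by auto
      have "(r, r) \<notin> c u"
      proof
        assume "(r, r) \<in> c u"
        then have "Id_on (S \<union> insert r A) \<subseteq> c u"
          using C(1,3) by (auto simp: Id_on_iff)
        then show False
          using sub cux by blast
      qed
      then show False
        using sub(1) u_not_top by (auto simp: Id_on_iff)
    qed
    ultimately show ?thesis
      using between [OF tr] r(1) by blast
  qed
  have topR: "topspace (subtopology K R) = R"
    by (auto simp: R_def)
  have "coded_by_coatoms (subtopology K R) U le t"
    unfolding coded_by_coatoms_def topR
  proof (intro conjI ballI allI impI)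
    show "le u u" if "u \<in> U" for u
      using le that by blast
    show "le u w" if "u \<in> U" "v \<in> U" "w \<in> U" "le u v" "le v w" for u v w
      using le that by blast
    show "t \<in> R \<rightarrow> U"
      using t by blast
    show "r = s" if "r \<in> R" "s \<in> R" "le (t r) (t s)" for r s
      using le_t [OF t(1)] t(2) that by (auto simp: R_def)
    show "isolated_coatom U le u \<longleftrightarrow> (\<exists>r\<in>R. le u (t r) \<and> le (t r) u)" if "u \<in> U" for u
      using coatom coatomD that by blast
    show "closedin (subtopology K R) F \<longleftrightarrow> (\<exists>u\<in>U. F = {r \<in> R. le u (t r)})" for F
    proof
      assume "closedin (subtopology K R) F"
      then obtain D where D: "closedin K D" "F = D \<inter> R"
        by (auto simp: closedin_subtopology)
      \<comment> \<open>\<open>D\<close> may meet \<open>S\<close> and may miss part of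
        \<open>A\<close>; cutting it down to the remainder and adding \<open>A\<close> leaves its
        trace on \<open>R\<close> unchanged.\<close>
      define C where "C = A \<union> (D \<inter> (topspace K - S))"
      have C: "closedin K C" "A \<subseteq> C" "C \<subseteq> topspace K - S"
        using D closedin_A closedin_remainder A_subset
        by (auto simp: C_def intro!: closedin_Un closedin_Int)
      obtain u where u: "u \<in> U" "c u = Id_on (S \<union> C)"
        using subspace [OF C] by blast
      have "F = {r \<in> R. le u (t r)}"
        using D u le_t [OF u(1)] by (auto simp: C_def R_def)
      then show "\<exists>u\<in>U. F = {r \<in> R. le u (t r)}"
        using u by blast
    next
      assume "\<exists>u\<in>U. F = {r \<in> R. le u (t r)}"
      then obtain u where u: "u \<in> U" "F = {r \<in> R. le u (t r)}"
        by blast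
      obtain C where C: "closedin K C" "A \<subseteq> C" "C \<subseteq> topspace K - S" "Id_on (S \<union> C) \<subseteq> c u"
          "c u \<subseteq> Id_on S \<union> C \<times> C"
        using kernelE [OF u(1)] by blast
      have "F = C \<inter> R"
        using u C le_t [OF u(1)] by (auto simp: R_def Id_on_iff)
      then show "closedin (subtopology K R) F"
        using C(1) by (auto simp: closedin_subtopology)
    qed
  qed
  then show thesis
    using that unfolding R_def by blast
qed

text \<open>Each class receives a chosen representative with resolving data, and its identification
  relation is the kernel of the resolving map.\<close>

lemma U_ext_coded:
  obtains t where "coded_by_coatoms (subtopology K ((topspace K - S) - A)) (U_ext X) (U_le X) t"
proof -
  have "\<exists>Z d T f. u = ext_class X (Z, d) \<and> is_extension X Z d \<and>
      resolves T f Z d \<and> closedin K (T - S) \<and> A \<subseteq> T" if u: "u \<in> U_ext X" for u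
  proof -
    obtain Z d where "u = ext_class X (Z, d)" and Z: "U_member X Z d"
      using u by (auto simp: U_ext_def U_member_def)
    moreover obtain T f where "resolves T f Z d" "closedin K (T - S)" "A \<subseteq> T"
      using U_member_resolved [OF Z] by blast
    ultimately show ?thesis
      unfolding U_member_def by blast
  qed
  then obtain Z d T f where cls: "\<And>u. u \<in> U_ext X \<Longrightarrow> u = ext_class X (Z u, d u)"
    and ext: "\<And>u. u \<in> U_ext X \<Longrightarrow> is_extension X (Z u) (d u)"
    and res: "\<And>u. u \<in> U_ext X \<Longrightarrow> resolves (T u) (f u) (Z u) (d u)"
    and clo: "\<And>u. u \<in> U_ext X \<Longrightarrow> closedin K (T u - S)"
    and AT: "\<And>u. u \<in> U_ext X \<Longrightarrow> A \<subseteq> T u"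
    by metis
  define c where "c u = {(p, q). p \<in> T u \<and> q \<in> T u \<and> f u p = f u q}" for u
  show thesis
  proof (rule kernels_coded [of "U_ext X" c "U_le X"])
    fix u assume u: "u \<in> U_ext X"
    have T: "S \<subseteq> T u" "T u \<subseteq> topspace K"
      using res [OF u] by (auto simp: resolves_def)
    have fibre: "q = p" if "p \<in> S" "q \<in> T u" "f u q = f u p" for p q
      using that resolves_fibre [OF res [OF u]] resolves_e [OF res [OF u]] by (auto simp: S_def)
    have "c u \<subseteq> Id_on S \<union> (T u - S) \<times> (T u - S)"
    proof (rule subrelI)
      fix p q assume "(p, q) \<in> c u"
      then show "(p, q) \<in> Id_on S \<union> (T u - S) \<times> (T u - S)"
        using fibre [of p q] fibre [of q p] by (auto simp: c_def)
    qed
    moreover have "Id_on (S \<union> (T u - S)) \<subseteq> c u" "sym (c u)"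
      using T by (auto simp: c_def sym_def)
    moreover have "A \<subseteq> T u - S" "T u - S \<subseteq> topspace K - S"
      using AT [OF u] A_subset T by auto
    ultimately show "c u \<in> kernels"
      unfolding kernels_def using clo [OF u] by blast
  next
    fix u v assume uv: "u \<in> U_ext X" "v \<in> U_ext X"
    have "U_le X u v \<longleftrightarrow> ext_le X (Z u, d u) (Z v, d v)"
      using U_le_ext_class [of X "(Z u, d u)" "(Z v, d v)"] cls ext uv by simp
    then show "U_le X u v \<longleftrightarrow> c v \<subseteq> c u"
      using ext_le_iff_resolves [OF res [OF uv(1)] res [OF uv(2)]] by (simp add: c_def)
  next
    fix C a b assume C: "closedin K C" "A \<subseteq> C" "C \<subseteq> topspace K - S" "a \<in> C" "b \<in> C"
    obtain Z' :: "'a set set topology" and d' f' where Z': "U_member X Z' d'" and r': "resolves (S \<union> C) f' Z' d'"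
      and ker: "{(p, q). p \<in> S \<union> C \<and> q \<in> S \<union> C \<and> f' p = f' q} = Id_on (S \<union> C) \<union> {(a, b), (b, a)}"
      using collapse_exists [OF C] by blast
    define u where "u = ext_class X (Z', d')"
    have u: "u \<in> U_ext X"
      using Z' unfolding U_ext_def u_def U_member_def by force
    \<comment> \<open>The collapsed space need not be the representative chosen for its class. The
      two are equivalent, so each lies below the other and their kernels coincide.\<close>
    have "(Z', d') \<in> ext_class X (Z u, d u)"
      using cls [OF u] Z' mem_ext_class_self [of X "(Z', d')"] by (simp add: u_def U_member_def)
    then have "ext_equiv X (Z u, d u) (Z', d')"
      by (simp add: ext_class_def)
    then have "ext_le X (Z u, d u) (Z', d')" "ext_le X (Z', d') (Z u, d u)"
      using ext_equiv_imp_ext_le ext [OF u] by auto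
    then have "c u = Id_on (S \<union> C) \<union> {(a, b), (b, a)}"
      using ext_le_iff_resolves [OF res [OF u] r'] ext_le_iff_resolves [OF r' res [OF u]] ker
      by (simp add: c_def)
    then show "\<exists>u\<in>U_ext X. c u = Id_on (S \<union> C) \<union> {(a, b), (b, a)}"
      using u by blast
  qed (use that in blast)
qed

end

theorem theorem2p32:
  fixes X :: "'a topology" and Y :: "'b topology"
    and K :: "'k topology" and eX :: "'a \<Rightarrow> 'k"
    and L :: "'l topology" and eY :: "'b \<Rightarrow> 'l"
  assumes "tychonoff_space X" and "tychonoff_space Y"
    and "locally_compact_space X" and "locally_compact_space Y"
    and "\<not> pseudocompact_space X" and "\<not> pseudocompact_space Y"
    and "order_isomorphic_U X Y"
    and "stone_cech X K eX" and "stone_cech Y L eY"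
  shows "subtopology K ((topspace K - eX ` topspace X) -
             K closure_of (topspace K - hewitt_in X K eX))
         homeomorphic_space
         subtopology L ((topspace L - eY ` topspace Y) -
             L closure_of (topspace L - hewitt_in Y L eY))"
proof -
  interpret X: stone_cech_nonpseudocompact X K eX
    using assms by unfold_locales
  interpret Y: stone_cech_nonpseudocompact Y L eY
    using assms by unfold_locales
  obtain s where s: "coded_by_coatoms (subtopology K ((topspace K - X.S) - X.A)) (U_ext X) (U_le X) s"
    using X.U_ext_coded by blast
  obtain t where t: "coded_by_coatoms (subtopology L ((topspace L - Y.S) - Y.A)) (U_ext Y) (U_le Y) t"
    using Y.U_ext_coded by blast
  obtain \<phi> where "bij_betw \<phi> (U_ext X) (U_ext Y)"
      "\<forall>A\<in>U_ext X. \<forall>B\<in>U_ext X. U_le X A B \<longleftrightarrow> U_le Y (\<phi> A) (\<phi> B)"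
    using assms(7) by (auto simp: order_isomorphic_U_def)
  then show ?thesis
    using coded_by_coatoms_homeomorphic [OF s t, of \<phi>]
    unfolding X.S_def X.A_def Y.S_def Y.A_def by blast
qed

end
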